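(* Let $\nu \in \mathcal{M}$, and consider the analytic function $-G_\nu$ from $\mathbb{C}^+$ to itself. Then there exists a unique probability measure $\mu \in \mathcal{M}$ such that $$-G_\nu(z) = F_\mu(z) - z, \qquad z \in \mathbb{C}^+ .$$ Moreover, for this $\mu$, $$-G_{\nu \boxplus \gamma_t}(z) = F_{\mathbb{B}_t(\mu)}(z) - z, \qquad \forall\, t>0,\ \forall\, z \in \mathbb{C}^+ ,$$ where $\gamma_t$ is the centered semicircular distribution of variance $t$.
   Context: $\mathcal{M}$ is the set of Borel probability measures on $\mathbb{R}$; $\mathbb{C}^+$ is the open upper half-plane. For $\mu \in \mathcal{M}$: $G_\mu(z) = \int_{\mathbb{R}} \frac{d\mu(s)}{z-s}$ is the Cauchy transform and $F_\mu(z) = 1/G_\mu(z)$ the reciprocal Cauchy transform; $F_\mu$ is an analytic self-map of $\mathbb{C}^+$. For every $\alpha>0$ there is $\beta>0$ such that $F_\mu$ has an analytic right inverse $F_\mu^{-1}$ on $\Gamma_{\alpha,\beta}=\{z\in\mathbb{C}^+ : |\Re z|<\alpha\,\Im z,\ \Im z>\beta\}$ with $F_\mu^{-1}(z)/z\to 1$ as $z\to\infty$ in $\Gamma_{\alpha,\beta}$; put $V_\mu(z) = F_\mu^{-1}(z)-z$ there. Free additive convolution $\boxplus$ is determined by $V_{\mu\boxplus\nu} = V_\mu+V_\nu$ on a common truncated cone. For $t\ge 1$, $\mu^{\boxplus t}\in\mathcal{M}$ is the unique probability measure with $V_{\mu^{\boxplus t}} = tV_\mu$ on a common truncated cone (it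 is known to exist). For $t>0$, the Boolean convolution power $\mu^{\uplus t}\in\mathcal{M}$ is the unique probability measure with $F_{\mu^{\uplus t}}(z) = tF_\mu(z)+(1-t)z$, $z\in\mathbb{C}^+$ (it always exists). For $t\ge0$, $\mathbb{B}_t(\mu) = \bigl( \mu^{\boxplus(1+t)} \bigr)^{\uplus(1/(1+t))}$. The measure $\gamma_t$ is $d\gamma_t(x) = \frac{1}{2\pi t}\sqrt{4t-x^2}\,dx$ on $[-2\sqrt{t},2\sqrt{t}]$. *)

theory Defs
  imports "HOL-Probability.Probability"
begin

definition upper_half_plane :: "complex set" where
  "upper_half_plane = {z. Im z > 0}"

definition cauchy_transform :: "real measure \<Rightarrow> complex \<Rightarrow> complex" where
  "cauchy_transform \<mu> z = (\<integral>s. 1 / (z - complex_of_real s) \<partial>\<mu>)"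

definition reciprocal_cauchy :: "real measure \<Rightarrow> complex \<Rightarrow> complex" where
  "reciprocal_cauchy \<mu> z = 1 / cauchy_transform \<mu> z"

definition truncated_cone :: "real \<Rightarrow> real \<Rightarrow> complex set" where
  "truncated_cone \<alpha> \<beta> = {z \<in> upper_half_plane. \<bar>Re z\<bar> < \<alpha> * Im z \<and> Im z > \<beta>}"

definition is_right_inverse_on ::
  "real measure \<Rightarrow> real \<Rightarrow> real \<Rightarrow> (complex \<Rightarrow> complex) \<Rightarrow> bool" where
  "is_right_inverse_on \<mu> \<alpha> \<beta> g \<longleftrightarrow>
     g analytic_on truncated_cone \<alpha> \<beta> \<and>
     g ` truncated_cone \<alpha> \<beta> \<subseteq> upper_half_plane \<and>
     (\<forall>z \<in> truncated_cone \<alpha> \<beta>. reciprocal_cauchy \<mu> (g z) = z) \<and>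
     ((\<lambda>z. g z / z) \<longlongrightarrow> 1) (inf at_infinity (principal (truncated_cone \<alpha> \<beta>)))"

(* The normalisation at infinity makes the right inverse unique on the cone, so V is the
   function V_mu there. It is kept as a relation because V_mu has no canonical domain:
   the admissible \<beta> depends on \<alpha> and on the measure. Values of V off the cone are
   irrelevant. *)
definition is_voiculescu_transform_on ::
  "real measure \<Rightarrow> real \<Rightarrow> real \<Rightarrow> (complex \<Rightarrow> complex) \<Rightarrow> bool" where
  "is_voiculescu_transform_on \<mu> \<alpha> \<beta> V \<longleftrightarrow>
     (\<exists>g. is_right_inverse_on \<mu> \<alpha> \<beta> g \<and> (\<forall>z \<in> truncated_cone \<alpha> \<beta>. V z = g z - z))"

definition free_convolution :: "real measure \<Rightarrow> real measure \<Rightarrow> real measure" where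
  "free_convolution \<mu> \<nu> = (THE \<rho>. real_distribution \<rho> \<and>
     (\<exists>\<alpha>>0. \<exists>\<beta>>0. \<exists>U V.
        is_voiculescu_transform_on \<mu> \<alpha> \<beta> U \<and>
        is_voiculescu_transform_on \<nu> \<alpha> \<beta> V \<and>
        is_voiculescu_transform_on \<rho> \<alpha> \<beta> (\<lambda>z. U z + V z)))"

(* Meaningful for t \<ge> 1. *)
definition free_power :: "real measure \<Rightarrow> real \<Rightarrow> real measure" where
  "free_power \<mu> t = (THE \<rho>. real_distribution \<rho> \<and>
     (\<exists>\<alpha>>0. \<exists>\<beta>>0. \<exists>V.
        is_voiculescu_transform_on \<mu> \<alpha> \<beta> V \<and>
        is_voiculescu_transform_on \<rho> \<alpha> \<beta> (\<lambda>z. complex_of_real t * V z)))"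

(* Meaningful for t > 0. *)
definition boolean_power :: "real measure \<Rightarrow> real \<Rightarrow> real measure" where
  "boolean_power \<mu> t = (THE \<rho>. real_distribution \<rho> \<and>
     (\<forall>z \<in> upper_half_plane.
        reciprocal_cauchy \<rho> z =
          complex_of_real t * reciprocal_cauchy \<mu> z + (1 - complex_of_real t) * z))"

definition BN_transform :: "real \<Rightarrow> real measure \<Rightarrow> real measure" where
  "BN_transform t \<mu> = boolean_power (free_power \<mu> (1 + t)) (1 / (1 + t))"

definition semicircular :: "real \<Rightarrow> real measure" where
  "semicircular t = density lborel (\<lambda>x. ennreal
     (indicator {- 2 * sqrt t .. 2 * sqrt t} x * (sqrt (4 * t - x\<^sup>2) / (2 * pi * t))))"

end

theory Submission
  imports Defs "HOL-Complex_Analysis.Complex_Analysis"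
begin

text \<open>
  Write \<open>H(w) = w + t G\<^sub>\<nu>(w)\<close> and let \<open>\<omega>\<close> be its right inverse on the upper half-plane: a fixed point of
  \<open>w \<mapsto> z - t G\<^sub>\<nu>(w)\<close>, which exists by Brouwer and is unique because the resolvent integral of two
  fixed points would have modulus below \<open>1/t\<close>. As the semicircle law has Voiculescu transform \<open>t/u\<close>, inverting gives
  \<open>G = G\<^sub>\<nu> \<circ> \<omega>\<close> for the free convolution of \<open>\<nu>\<close> with it. If \<open>F\<^sub>\<mu>(z) = z - G\<^sub>\<nu>(z)\<close>, then
  \<open>H \<circ> F\<^sub>\<mu>\<^sup>-\<^sup>1 = (1 + t) F\<^sub>\<mu>\<^sup>-\<^sup>1 - t id\<close>, so the same \<open>\<omega>\<close> gives
  \<open>F = F\<^sub>\<mu> \<circ> \<omega>\<close> for the free power of exponent \<open>1 + t\<close>. The Boolean power turns \<open>\<omega> - G\<^sub>\<nu>(\<omega>)\<close> into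
  \<open>z - G\<^sub>\<nu>(\<omega>)\<close>, which is the claim. That all these functions are Cauchy transforms of probability measures
  follows from the Poisson formula on a half-plane and Helly's theorem.
\<close>

section \<open>Cauchy transforms\<close>

text \<open>The convolutions are defined by \<open>THE\<close> from identities between V-functions
  on unspecified cones, so even their existence has to be proved: each needs an explicit witness
  measure and a uniqueness argument. The function \<omega> supplies the witnesses because it lives
  on the whole upper half-plane and satisfies Im \<omega>(z) >= Im z. Hence for every probability
  measure S the composite of G_S with \<omega> keeps the sign, the bound 1 / Im z and the
  normalisation i y G(i y) -> 1 from which a measure can be built. Taking S = \<nu> and S = \<mu>
  with one \<omega>, made from \<nu> alone, treats free convolution and free power together.
  Uniqueness has three layers: right inverses agree far out in a cone, where G is injective; a
  shared right inverse forces equal Cauchy transforms by the identity theorem; Stieltjes inversion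
  recovers the measure. Moments may be infinite, so asymptotics go through a truncated first moment.
  Boundary values of G may fail to exist; moving up by i \<epsilon> makes them smooth, and
  \<epsilon> -> 0 is taken on the level of measures.\<close>

lemma mem_upper_half_plane [simp]: "z \<in> upper_half_plane \<longleftrightarrow> Im z > 0"
  by (simp add: upper_half_plane_def)

lemma open_upper_half_plane: "open upper_half_plane"
  by (simp add: upper_half_plane_def open_halfspace_Im_gt)

lemma convex_upper_half_plane: "convex upper_half_plane"
  by (simp add: upper_half_plane_def convex_halfspace_Im_gt)

lemma norm_diff_of_real_ge_Im: "Im z \<le> norm (z - complex_of_real s)"
  using abs_Im_le_cmod[of "z - complex_of_real s"] by simp

lemma upper_half_plane_diff_of_real_nonzero: "Im z > 0 \<Longrightarrow> z - complex_of_real s \<noteq> 0"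
  by (auto simp: complex_eq_iff)

lemma norm_inverse_diff_of_real_le:
  assumes "Im z > 0"
  shows "norm (1 / (z - complex_of_real s)) \<le> 1 / Im z"
  using norm_diff_of_real_ge_Im[of z s] assms
  by (simp add: norm_divide divide_simps)

text \<open>Up to sign this is the divided difference of the Cauchy transform, extended to the
  diagonal, where it is minus the derivative. Keeping it away from 0 gives injectivity far out in a
  cone; bounding it above gives uniqueness of the subordination fixed point.\<close>

definition resolvent_integral :: "real measure \<Rightarrow> complex \<Rightarrow> complex \<Rightarrow> complex" where
  "resolvent_integral M z w = (\<integral>s. 1 / ((z - complex_of_real s) * (w - complex_of_real s)) \<partial>M)"

context real_distribution
begin

lemma integrable_bounded:
  fixes f :: "real \<Rightarrow> 'a::{banach, second_countable_topology}"
  assumes "f \<in> borel_measurable borel" "\<And>s. norm (f s) \<le> B"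
  shows "integrable M f"
  using assms by (intro integrable_const_bound[where B = B]) auto

lemma norm_integral_le:
  fixes f :: "real \<Rightarrow> 'a::{banach, second_countable_topology}"
  assumes "f \<in> borel_measurable borel" "\<And>s. norm (f s) \<le> B"
  shows "norm (\<integral>s. f s \<partial>M) \<le> B"
proof -
  have "norm (\<integral>s. f s \<partial>M) \<le> (\<integral>s. norm (f s) \<partial>M)"
    by (rule integral_norm_bound)
  also have "\<dots> \<le> (\<integral>s. B \<partial>M)"
    using assms integrable_bounded[OF assms] by (intro integral_mono integrable_norm) auto
  finally show ?thesis by (simp add: prob_space[simplified])
qed

lemma integrable_resolvent:
  assumes "Im z > 0"
  shows "integrable M (\<lambda>s. 1 / (z - complex_of_real s))"
  using norm_inverse_diff_of_real_le[OF assms] by (intro integrable_bounded) auto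

lemma norm_resolvent_product_le:
  assumes "Im z > 0" "Im w > 0"
  shows "norm (1 / ((z - complex_of_real s) * (w - complex_of_real s))) \<le> 1 / (Im z * Im w)"
proof -
  have "norm (1 / (z - complex_of_real s)) * norm (1 / (w - complex_of_real s)) \<le> (1 / Im z) * (1 / Im w)"
    using norm_inverse_diff_of_real_le assms by (intro mult_mono) auto
  then show ?thesis by (simp add: norm_divide norm_mult)
qed

lemma integrable_resolvent_product:
  assumes "Im z > 0" "Im w > 0"
  shows "integrable M (\<lambda>s. 1 / ((z - complex_of_real s) * (w - complex_of_real s)))"
  using norm_resolvent_product_le[OF assms] by (intro integrable_bounded) auto

lemma integrable_norm_resolvent_sq:
  assumes "Im z > 0"
  shows "integrable M (\<lambda>s. 1 / (norm (z - complex_of_real s))\<^sup>2)"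
proof (intro integrable_bounded[where B = "1 / (Im z)\<^sup>2"])
  fix s
  have "(Im z)\<^sup>2 \<le> (norm (z - complex_of_real s))\<^sup>2"
    using norm_diff_of_real_ge_Im[of z s] assms by (intro power_mono) auto
  then show "norm (1 / (norm (z - complex_of_real s))\<^sup>2) \<le> 1 / (Im z)\<^sup>2"
    using assms by (auto simp: divide_simps)
qed auto

lemma norm_cauchy_transform_le:
  assumes "Im z > 0"
  shows "norm (cauchy_transform M z) \<le> 1 / Im z"
  unfolding cauchy_transform_def
  using norm_inverse_diff_of_real_le[OF assms] by (intro norm_integral_le) auto

lemma Im_resolvent: "Im (1 / (z - complex_of_real s)) = - Im z * (1 / (norm (z - complex_of_real s))\<^sup>2)"
  by (simp add: Im_divide cmod_power2)

lemma Im_cauchy_transform: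
  assumes "Im z > 0"
  shows "Im (cauchy_transform M z) = - Im z * (\<integral>s. 1 / (norm (z - complex_of_real s))\<^sup>2 \<partial>M)"
proof -
  have "Im (cauchy_transform M z) = (\<integral>s. Im (1 / (z - complex_of_real s)) \<partial>M)"
    unfolding cauchy_transform_def using integrable_resolvent[OF assms] by simp
  also have "\<dots> = - Im z * (\<integral>s. 1 / (norm (z - complex_of_real s))\<^sup>2 \<partial>M)"
    unfolding Im_resolvent by (rule integral_mult_right_zero)
  finally show ?thesis .
qed

lemma integral_norm_resolvent_sq_pos:
  assumes "Im z > 0"
  shows "(\<integral>s. 1 / (norm (z - complex_of_real s))\<^sup>2 \<partial>M) > 0"
proof -
  have "(\<integral>s. 1 / (norm (z - complex_of_real s))\<^sup>2 \<partial>M) > (\<integral>s. 0 \<partial>M)"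
    using integrable_norm_resolvent_sq[OF assms] upper_half_plane_diff_of_real_nonzero[OF assms]
    by (intro integral_less_AE_space) (auto simp: emeasure_space_1[simplified])
  then show ?thesis by simp
qed

lemma Im_cauchy_transform_neg:
  assumes "Im z > 0"
  shows "Im (cauchy_transform M z) < 0"
  using Im_cauchy_transform[OF assms] integral_norm_resolvent_sq_pos[OF assms] assms
  by (simp add: mult_pos_pos)

lemma cauchy_transform_nonzero:
  assumes "Im z > 0"
  shows "cauchy_transform M z \<noteq> 0"
  using Im_cauchy_transform_neg[OF assms] by auto

lemma cauchy_transform_diff:
  assumes "Im z > 0" "Im w > 0"
  shows "cauchy_transform M z - cauchy_transform M w = (w - z) * resolvent_integral M z w"
proof -
  have "cauchy_transform M z - cauchy_transform M w =
      (\<integral>s. 1 / (z - complex_of_real s) - 1 / (w - complex_of_real s) \<partial>M)"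
    unfolding cauchy_transform_def using integrable_resolvent assms by simp
  also have "\<dots> = (\<integral>s. (w - z) * (1 / ((z - complex_of_real s) * (w - complex_of_real s))) \<partial>M)"
    using assms upper_half_plane_diff_of_real_nonzero
    by (intro Bochner_Integration.integral_cong) (auto simp: field_simps)
  also have "\<dots> = (w - z) * resolvent_integral M z w"
    unfolding resolvent_integral_def by (rule integral_mult_right_zero)
  finally show ?thesis .
qed

text \<open>AM-GM separates the two factors, and the integral of 1 / |z - s|^2 is - Im G(z) / Im z.
  The bound is stated in these quotients because the imaginary part of the fixed-point equation
  controls exactly them.\<close>

lemma norm_resolvent_integral_le:
  assumes "Im z > 0" "Im w > 0"
  shows "norm (resolvent_integral M z w) \<le>
    (- Im (cauchy_transform M z) / Im z - Im (cauchy_transform M w) / Im w) / 2"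
proof -
  let ?a = "\<lambda>s. 1 / (norm (z - complex_of_real s))\<^sup>2" and ?b = "\<lambda>s. 1 / (norm (w - complex_of_real s))\<^sup>2"
  have le: "norm (1 / ((z - complex_of_real s) * (w - complex_of_real s))) \<le> (?a s + ?b s) / 2" for s
  proof -
    let ?x = "1 / norm (z - complex_of_real s)" and ?y = "1 / norm (w - complex_of_real s)"
    have "0 \<le> (?x - ?y)\<^sup>2" by simp
    then have "?x * ?y \<le> (?x\<^sup>2 + ?y\<^sup>2) / 2" by (simp add: power2_diff)
    then show ?thesis by (simp add: norm_divide norm_mult power_divide)
  qed
  have "norm (resolvent_integral M z w) \<le>
      (\<integral>s. norm (1 / ((z - complex_of_real s) * (w - complex_of_real s))) \<partial>M)"
    unfolding resolvent_integral_def by (rule integral_norm_bound)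
  also have "\<dots> \<le> (\<integral>s. (?a s + ?b s) / 2 \<partial>M)"
    using assms le integrable_norm_resolvent_sq
    by (intro integral_mono integrable_norm integrable_resolvent_product
        integrable_divide Bochner_Integration.integrable_add) auto
  also have "\<dots> = ((\<integral>s. ?a s \<partial>M) + (\<integral>s. ?b s \<partial>M)) / 2"
    using assms integrable_norm_resolvent_sq by simp
  finally show ?thesis
    using Im_cauchy_transform assms by simp
qed

lemma holomorphic_cauchy_transform: "cauchy_transform M holomorphic_on upper_half_plane"
proof -
  have "(cauchy_transform M has_field_derivative - resolvent_integral M z z) (at z)"
    if z: "Im z > 0" for z
  proof -
    \<comment> \<open>On this smaller half-plane the moving factor of the kernel is at most 2 / Im
      z, so a constant dominates.\<close>
    let ?S = "{w. Im w > Im z / 2}"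
    have op: "open ?S" by (rule open_halfspace_Im_gt)
    have "((\<lambda>w. - resolvent_integral M w z) \<longlongrightarrow> - resolvent_integral M z z) (at z within ?S)"
      unfolding tendsto_at_iff_sequentially
    proof (intro allI impI, unfold o_def, rule tendsto_minus)
      fix X assume X: "\<forall>i. X i \<in> ?S - {z}" "X \<longlonglongrightarrow> z"
      show "(\<lambda>n. resolvent_integral M (X n) z) \<longlonglongrightarrow> resolvent_integral M z z"
        unfolding resolvent_integral_def
      proof (rule integral_dominated_convergence[where w = "\<lambda>_. 1 / (Im z / 2 * Im z)"])
        show "AE s in M. (\<lambda>n. 1 / ((X n - complex_of_real s) * (z - complex_of_real s))) \<longlonglongrightarrow>
            1 / ((z - complex_of_real s) * (z - complex_of_real s))"
          using upper_half_plane_diff_of_real_nonzero[OF z] by (intro AE_I2 tendsto_intros X) auto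
        fix n
        have Xn: "Im (X n) > Im z / 2" using X by auto
        have "norm (1 / ((X n - complex_of_real s) * (z - complex_of_real s))) \<le> 1 / (Im (X n) * Im z)" for s
          using Xn z by (intro norm_resolvent_product_le) auto
        moreover have "1 / (Im (X n) * Im z) \<le> 1 / (Im z / 2 * Im z)"
          using Xn z by (intro divide_left_mono mult_right_mono mult_pos_pos) auto
        ultimately show "AE s in M. norm (1 / ((X n - complex_of_real s) * (z - complex_of_real s)))
            \<le> 1 / (Im z / 2 * Im z)"
          by (intro AE_I2) (rule order_trans)
      qed auto
    qed
    then have "((\<lambda>w. (cauchy_transform M w - cauchy_transform M z) / (w - z)) \<longlongrightarrow>
        - resolvent_integral M z z) (at z within ?S)"
    proof (rule Lim_transform_eventually)
      show "\<forall>\<^sub>F w in at z within ?S. - resolvent_integral M w z =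
          (cauchy_transform M w - cauchy_transform M z) / (w - z)"
        unfolding eventually_at_filter
        using z by (intro always_eventually) (auto simp: cauchy_transform_diff divide_simps algebra_simps)
    qed
    then show ?thesis
      using at_within_open[of z ?S] op z by (simp add: has_field_derivative_iff del: less_divide_eq_numeral1 divide_less_eq_numeral1)
  qed
  then show ?thesis
    unfolding holomorphic_on_def field_differentiable_def
    by (metis has_field_derivative_at_within mem_upper_half_plane)
qed

end

section \<open>Asymptotics in truncated cones and right inverses\<close>

context real_distribution
begin

text \<open>A bounded substitute for (first moment) / y, which may be infinite. It tends to 0 for
  every distribution and measures how fast z G(z) tends to 1 in a cone.\<close>

definition tail_integral :: "real \<Rightarrow> real" where
  "tail_integral y = (\<integral>s. min 1 (\<bar>s\<bar> / y) \<partial>M)"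

lemma integrable_tail: "y > 0 \<Longrightarrow> integrable M (\<lambda>s. min 1 (\<bar>s\<bar> / y))"
  by (intro integrable_bounded[where B = 1]) auto

lemma tail_integral_nonneg: "y > 0 \<Longrightarrow> tail_integral y \<ge> 0"
  unfolding tail_integral_def by (intro Bochner_Integration.integral_nonneg) auto

lemma tail_integral_antimono:
  assumes "0 < y" "y \<le> y'"
  shows "tail_integral y' \<le> tail_integral y"
  unfolding tail_integral_def using assms
  by (intro integral_mono integrable_tail min.mono divide_left_mono) auto

lemma tail_integral_tendsto: "(tail_integral \<longlongrightarrow> 0) at_top"
proof -
  have "((\<lambda>y. \<integral>s. min 1 (\<bar>s\<bar> / y) \<partial>M) \<longlongrightarrow> (\<integral>s. 0 \<partial>M)) at_top"
  proof (rule integral_dominated_convergence_at_top[where w = "\<lambda>_. 1"])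
    show "AE s in M. ((\<lambda>y. min 1 (\<bar>s\<bar> / y)) \<longlongrightarrow> 0) at_top"
    proof (intro AE_I2)
      fix s :: real
      have "((\<lambda>y. \<bar>s\<bar> / y) \<longlongrightarrow> 0) at_top"
        by (intro tendsto_divide_0[OF tendsto_const] filterlim_at_top_imp_at_infinity filterlim_ident)
      then have "((\<lambda>y. min 1 (\<bar>s\<bar> / y)) \<longlongrightarrow> min 1 0) at_top"
        by (intro tendsto_min tendsto_const)
      then show "((\<lambda>y. min 1 (\<bar>s\<bar> / y)) \<longlongrightarrow> 0) at_top" by simp
    qed
    show "\<forall>\<^sub>F y in at_top. AE s in M. norm (min 1 (\<bar>s\<bar> / y)) \<le> 1"
      using eventually_gt_at_top[of 0] by eventually_elim auto
  qed auto
  then show ?thesis by (simp add: tail_integral_def[abs_def])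
qed

text \<open>Two bounds are merged: |s| / y from the height of z, good for small s, and 1 + c from s
  / (z - s) = z / (z - s) - 1, good for large s. The number c plays the role of the aperture of a
  cone.\<close>

lemma norm_div_diff_of_real_le:
  assumes "Im z > 0" "norm z \<le> c * Im z" "0 < y" "y \<le> Im z"
  shows "norm (complex_of_real s / (z - complex_of_real s)) \<le> (1 + c) * min 1 (\<bar>s\<bar> / y)"
proof -
  have c: "c \<ge> 1"
  proof (rule ccontr)
    assume "\<not> c \<ge> 1"
    then have "c * Im z < 1 * Im z" using assms by (intro mult_strict_right_mono) auto
    then show False using assms abs_Im_le_cmod[of z] by linarith
  qed
  have ge: "Im z \<le> norm (z - complex_of_real s)" by (rule norm_diff_of_real_ge_Im)
  have "norm (complex_of_real s / (z - complex_of_real s)) \<le> \<bar>s\<bar> / y"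
    using ge assms by (auto simp: norm_divide intro!: divide_left_mono mult_pos_pos)
  also have "\<dots> \<le> (1 + c) * (\<bar>s\<bar> / y)"
    using c assms mult_right_mono[of 1 "1 + c" "\<bar>s\<bar> / y"] by simp
  finally have 1: "norm (complex_of_real s / (z - complex_of_real s)) \<le> (1 + c) * (\<bar>s\<bar> / y)" .
  have "complex_of_real s / (z - complex_of_real s) = z / (z - complex_of_real s) - 1"
    using upper_half_plane_diff_of_real_nonzero[OF assms(1), of s] by (simp add: field_simps)
  then have "norm (complex_of_real s / (z - complex_of_real s)) \<le> norm (z / (z - complex_of_real s)) + 1"
    using norm_triangle_ineq4[of "z / (z - complex_of_real s)" 1] by simp
  also have "norm (z / (z - complex_of_real s)) \<le> (c * Im z) / Im z"
    unfolding norm_divide using ge assms c by (intro frac_le) auto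
  also have "\<dots> = c" using assms by simp
  finally have 2: "norm (complex_of_real s / (z - complex_of_real s)) \<le> (1 + c) * 1" by simp
  show ?thesis using 1 2 by (auto simp: min_def)
qed

lemma norm_mult_cauchy_transform_minus_1:
  assumes "Im z > 0" "norm z \<le> c * Im z"
  shows "norm (z * cauchy_transform M z - 1) \<le> (1 + c) * tail_integral (Im z)"
proof -
  have eq: "complex_of_real s / (z - complex_of_real s) = z * (1 / (z - complex_of_real s)) - 1" for s
    using upper_half_plane_diff_of_real_nonzero[OF assms(1), of s] by (simp add: field_simps)
  have int: "integrable M (\<lambda>s. complex_of_real s / (z - complex_of_real s))"
    unfolding eq by (intro Bochner_Integration.integrable_diff integrable_mult_right integrable_resolvent assms) auto
  have "z * cauchy_transform M z - 1 = (\<integral>s. complex_of_real s / (z - complex_of_real s) \<partial>M)"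
    unfolding eq cauchy_transform_def
    using integrable_resolvent[OF assms(1)] by (simp add: prob_space[simplified] del: times_divide_eq_right)
  then have "norm (z * cauchy_transform M z - 1) \<le>
      (\<integral>s. norm (complex_of_real s / (z - complex_of_real s)) \<partial>M)"
    using integral_norm_bound by metis
  also have "\<dots> \<le> (\<integral>s. (1 + c) * min 1 (\<bar>s\<bar> / Im z) \<partial>M)"
    using assms norm_div_diff_of_real_le
    by (intro integral_mono integrable_norm int integrable_mult_right integrable_tail) auto
  finally show ?thesis by (simp add: tail_integral_def)
qed

text \<open>With a = s / (z - s) and b = s / (w - s) the integrand is (1 + a) (1 + b) - 1 = a + b +
  a b. Each of the three terms is at most (1 + c)^2 times the truncated |s| / y, whence the
  constant.\<close>

lemma norm_mult_resolvent_integral_minus_1: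
  assumes z: "norm z \<le> c * Im z" "y \<le> Im z" and w: "norm w \<le> c * Im w" "y \<le> Im w" and y: "0 < y"
    and c: "0 \<le> c"
  shows "norm (z * w * resolvent_integral M z w - 1) \<le> 3 * (1 + c)\<^sup>2 * tail_integral y"
proof -
  have pos: "Im z > 0" "Im w > 0" using z w y by auto
  let ?a = "\<lambda>s. complex_of_real s / (z - complex_of_real s)"
  let ?b = "\<lambda>s. complex_of_real s / (w - complex_of_real s)"
  let ?f = "\<lambda>s. z * w * (1 / ((z - complex_of_real s) * (w - complex_of_real s))) - 1"
  have eq: "?f s = ?a s + ?b s + ?a s * ?b s" for s
  proof -
    have "z / (z - complex_of_real s) = 1 + ?a s" "w / (w - complex_of_real s) = 1 + ?b s"
      using upper_half_plane_diff_of_real_nonzero[of _ s] pos by (auto simp: field_simps)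
    moreover have "?f s = (z / (z - complex_of_real s)) * (w / (w - complex_of_real s)) - 1" by simp
    ultimately show ?thesis by (simp add: algebra_simps)
  qed
  have int: "integrable M ?f"
    using pos by (intro Bochner_Integration.integrable_diff integrable_mult_right integrable_resolvent_product) auto
  have "norm (?f s) \<le> 3 * (1 + c)\<^sup>2 * min 1 (\<bar>s\<bar> / y)" for s
  proof -
    define k where "k = min 1 (\<bar>s\<bar> / y)"
    have k: "0 \<le> k" "k \<le> 1" using y by (auto simp: k_def)
    have a: "norm (?a s) \<le> (1 + c) * k" and b: "norm (?b s) \<le> (1 + c) * k"
      unfolding k_def using z w y pos norm_div_diff_of_real_le by auto
    have "norm (?f s) \<le> norm (?a s) + norm (?b s) + norm (?a s) * norm (?b s)"
      unfolding eq norm_mult[symmetric] by (intro norm_triangle_le add_mono order_refl norm_triangle_ineq)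
    also have "\<dots> \<le> (1 + c) * k + (1 + c) * k + ((1 + c) * k) * ((1 + c) * k)"
      using a b c k by (intro add_mono mult_mono) auto
    also have "\<dots> = (1 + c) * k * (2 + (1 + c) * k)" by (simp add: algebra_simps)
    also have "\<dots> \<le> (1 + c) * k * (2 * (1 + c) + (1 + c) * 1)"
      using c k by (intro mult_left_mono add_mono) auto
    finally show ?thesis by (simp add: k_def power2_eq_square algebra_simps)
  qed
  note le = this
  have "z * w * resolvent_integral M z w - 1 = (\<integral>s. ?f s \<partial>M)"
    unfolding resolvent_integral_def
    using integrable_resolvent_product[OF pos] by (simp add: prob_space[simplified] del: times_divide_eq_right)
  then have "norm (z * w * resolvent_integral M z w - 1) \<le> (\<integral>s. norm (?f s) \<partial>M)"
    using integral_norm_bound by metis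
  also have "\<dots> \<le> (\<integral>s. 3 * (1 + c)\<^sup>2 * min 1 (\<bar>s\<bar> / y) \<partial>M)"
    using le y by (intro integral_mono integrable_norm int integrable_mult_right integrable_tail) auto
  finally show ?thesis by (simp add: tail_integral_def)
qed

end

text \<open>In the cone |z| <= (1 + \<alpha>) Im z, so the radius is at most Im z / 2: the disc
  about z loses at most half the height and stays in a wider cone. Fixed points and values of right
  inverses are located in this disc.\<close>

lemma truncated_cone_ball:
  assumes z: "z \<in> truncated_cone \<alpha> \<beta>" and a: "\<alpha> > 0" and w: "norm (w - z) \<le> norm z / (2 * (1 + \<alpha>))"
  shows "Im w \<ge> Im z / 2" "norm w \<le> 4 * (1 + \<alpha>) * Im w" "norm w \<le> 2 * norm z" "Im z \<ge> norm z / (1 + \<alpha>)"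
proof -
  have Imz: "Im z > 0" "\<bar>Re z\<bar> < \<alpha> * Im z" using z by (auto simp: truncated_cone_def)
  have nz: "norm z \<le> (1 + \<alpha>) * Im z" using cmod_le[of z] Imz by (simp add: algebra_simps)
  show i: "Im z \<ge> norm z / (1 + \<alpha>)" using nz a by (simp add: divide_simps mult.commute)
  have "\<bar>Im w - Im z\<bar> \<le> norm (w - z)" using abs_Im_le_cmod[of "w - z"] by simp
  also have "\<dots> \<le> (norm z / (1 + \<alpha>)) / 2" using w by (simp only: divide_divide_eq_left mult.commute)
  also have "\<dots> \<le> Im z / 2" by (rule divide_right_mono[OF i]) simp
  finally show 1: "Im w \<ge> Im z / 2" by linarith
  have "norm w \<le> norm z + norm (w - z)" using norm_triangle_ineq[of z "w - z"] by simp
  also have "norm (w - z) \<le> norm z" using w a divide_left_mono[of 1 "2 * (1 + \<alpha>)" "norm z"] by simp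
  finally show 2: "norm w \<le> 2 * norm z" by simp
  also have "\<dots> \<le> 2 * ((1 + \<alpha>) * (2 * Im w))"
    using nz 1 a by (intro mult_left_mono order_trans[OF nz]) auto
  finally show "norm w \<le> 4 * (1 + \<alpha>) * Im w" by (simp add: algebra_simps)
qed

lemma open_truncated_cone: "open (truncated_cone \<alpha> \<beta>)"
proof -
  have "truncated_cone \<alpha> \<beta> = {z. Im z > 0} \<inter> {z. \<bar>Re z\<bar> < \<alpha> * Im z} \<inter> {z. \<beta> < Im z}"
    by (auto simp: truncated_cone_def)
  moreover have "open {z. Im z > (0::real)}" "open {z. \<bar>Re z\<bar> < \<alpha> * Im z}" "open {z. \<beta> < Im z}"
    by (intro open_Collect_less continuous_intros)+
  ultimately show ?thesis by auto
qed

lemma truncated_cone_mono: "\<alpha>' \<le> \<alpha> \<Longrightarrow> \<beta> \<le> \<beta>' \<Longrightarrow> truncated_cone \<alpha>' \<beta>' \<subseteq> truncated_cone \<alpha> \<beta>"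
  by (auto simp: truncated_cone_def intro: order_less_le_trans mult_right_mono)

lemma truncated_cone_nonempty:
  assumes "\<alpha> > 0"
  shows "truncated_cone \<alpha> \<beta> \<noteq> {}"
proof -
  have "Complex 0 (\<bar>\<beta>\<bar> + 1) \<in> truncated_cone \<alpha> \<beta>" using assms by (auto simp: truncated_cone_def)
  then show ?thesis by auto
qed

lemma is_right_inverse_on_mono:
  assumes "is_right_inverse_on \<mu> \<alpha> \<beta> g" "\<alpha>' \<le> \<alpha>" "\<beta> \<le> \<beta>'"
  shows "is_right_inverse_on \<mu> \<alpha>' \<beta>' g"
proof -
  note sub = truncated_cone_mono[OF assms(2,3)]
  have "inf at_infinity (principal (truncated_cone \<alpha>' \<beta>')) \<le> inf at_infinity (principal (truncated_cone \<alpha> \<beta>))"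
    using sub by (intro inf_mono) auto
  then show ?thesis
    using assms sub analytic_on_subset[OF _ sub, of g] unfolding is_right_inverse_on_def
    by (blast intro: tendsto_mono)
qed

text \<open>Turns the normalisation at infinity into membership of the disc of
  \<open>truncated_cone_ball\<close>.\<close>

lemma right_inverse_near:
  assumes a: "\<alpha> > 0" and k: "is_right_inverse_on \<mu> \<alpha> \<beta> k"
  obtains b where "\<And>z. z \<in> truncated_cone \<alpha> \<beta> \<Longrightarrow> norm z \<ge> b \<Longrightarrow> norm (k z - z) \<le> norm z / (2 * (1 + \<alpha>))"
proof -
  let ?r = "1 / (2 * (1 + \<alpha>))"
  have "((\<lambda>z. k z / z) \<longlongrightarrow> 1) (inf at_infinity (principal (truncated_cone \<alpha> \<beta>)))"
    using k by (simp add: is_right_inverse_on_def)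
  then have "\<forall>\<^sub>F z in inf at_infinity (principal (truncated_cone \<alpha> \<beta>)). dist (k z / z) 1 < ?r"
    using a by (intro tendstoD) auto
  then obtain b where b: "\<And>z. norm z \<ge> b \<Longrightarrow> z \<in> truncated_cone \<alpha> \<beta> \<Longrightarrow> dist (k z / z) 1 < ?r"
    by (auto simp: eventually_inf_principal eventually_at_infinity)
  have "norm (k z - z) \<le> norm z / (2 * (1 + \<alpha>))" if z: "z \<in> truncated_cone \<alpha> \<beta>" "norm z \<ge> b" for z
  proof -
    have z0: "z \<noteq> 0" using z by (auto simp: truncated_cone_def)
    have "k z - z = z * (k z / z - 1)" using z0 by (simp add: field_simps)
    then have "norm (k z - z) = norm z * norm (k z / z - 1)" by (metis norm_mult)
    also have "\<dots> \<le> norm z * ?r" using b[OF z(2,1)] by (intro mult_left_mono) (auto simp: dist_norm)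
    finally show ?thesis by simp
  qed
  then show thesis by (rule that)
qed

section \<open>Existence and uniqueness of right inverses of F\<close>

context real_distribution
begin

lemma exists_small_tail:
  assumes "e > 0" "C \<ge> 0"
  obtains y where "y > 0" "C * tail_integral y < e"
proof -
  have "((\<lambda>y. C * tail_integral y) \<longlongrightarrow> C * 0) at_top"
    by (intro tendsto_intros tail_integral_tendsto)
  then have "\<forall>\<^sub>F y in at_top. C * tail_integral y < e"
    using assms by (intro order_tendstoD(2)[of _ "C * 0"]) auto
  then have "\<forall>\<^sub>F y in at_top. C * tail_integral y < e \<and> y > 0"
    using eventually_gt_at_top[of 0] by (rule eventually_conj)
  then show ?thesis using that eventually_happens[of _ "at_top :: real filter"] by auto
qed

text \<open>The assumption puts z w times the divided difference at distance less than 1 from 1, so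
  the divided difference never vanishes.\<close>

lemma inj_on_cauchy_transform:
  assumes "c > 0" "y > 0" "3 * (1 + c)\<^sup>2 * tail_integral y < 1"
  shows "inj_on (cauchy_transform M) {z. norm z < c * Im z \<and> Im z > y}"
proof (rule inj_onI)
  fix z w assume zw: "z \<in> {z. norm z < c * Im z \<and> Im z > y}" "w \<in> {z. norm z < c * Im z \<and> Im z > y}"
    and eq: "cauchy_transform M z = cauchy_transform M w"
  have "norm (z * w * resolvent_integral M z w - 1) \<le> 3 * (1 + c)\<^sup>2 * tail_integral y"
    using zw assms by (intro norm_mult_resolvent_integral_minus_1) auto
  then have "resolvent_integral M z w \<noteq> 0" using assms by auto
  then show "z = w" using cauchy_transform_diff[of z w] eq zw assms by auto
qed

lemma holomorphic_reciprocal_cauchy: "reciprocal_cauchy M holomorphic_on upper_half_plane"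
  unfolding reciprocal_cauchy_def[abs_def]
  using cauchy_transform_nonzero by (intro holomorphic_intros holomorphic_cauchy_transform) auto

text \<open>Far out F is a small relative perturbation of the identity. Injectivity there gives a
  holomorphic inverse on the image of \<open>S\<close>, and Brouwer's theorem shows that this image
  contains the cone.\<close>

lemma exists_right_inverse:
  assumes a: "\<alpha> > 0"
  obtains \<beta> g where "\<beta> > 0" "is_right_inverse_on M \<alpha> \<beta> g"
proof -
  \<comment> \<open>\<open>4 * (1 + \<alpha>)\<close> is the aperture delivered by
    \<open>truncated_cone_ball\<close>; the extra 1 makes the inequality in \<open>S\<close>
    strict.\<close>
  define c where "c = 4 * (1 + \<alpha>) + 1"
  define r where "r = 1 / (2 * (1 + \<alpha>))"
  have c: "c > 0" "c \<ge> 1" and r: "0 < r" "r \<le> 1/2" using a by (auto simp: c_def r_def field_simps)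
  \<comment> \<open>The choice \<open>r / 4\<close> makes the relative error of F on
    \<open>S\<close> at most \<open>r / 2\<close>; on the disc, where |w| <= 2 |z|, the absolute
    error is then at most r |z|, the radius itself.\<close>
  obtain y where y: "y > 0" "3 * (1 + c)\<^sup>2 * tail_integral y < r / 4"
    using exists_small_tail[of "r / 4" "3 * (1 + c)\<^sup>2"] r by auto
  define S where "S = {z. norm z < c * Im z \<and> Im z > y}"
  have "open S"
    unfolding S_def by (intro open_Collect_conj open_Collect_less continuous_intros)
  have SU: "S \<subseteq> upper_half_plane" using y by (auto simp: S_def)
  have "inj_on (cauchy_transform M) S"
    unfolding S_def using c y r by (intro inj_on_cauchy_transform) auto
  then have "inj_on (reciprocal_cauchy M) S"
    by (auto simp: inj_on_def reciprocal_cauchy_def)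
  then obtain g where g: "g holomorphic_on (reciprocal_cauchy M ` S)"
      "\<And>w. w \<in> S \<Longrightarrow> g (reciprocal_cauchy M w) = w"
    using holomorphic_has_inverse[of "reciprocal_cauchy M" S] \<open>open S\<close>
      holomorphic_on_subset[OF holomorphic_reciprocal_cauchy SU] by metis
  have F_near: "norm (w - reciprocal_cauchy M w) \<le> 2 * (1 + c) * tail_integral (Im w) * norm w"
    "2 * (1 + c) * tail_integral (Im w) \<le> r / 2" if w: "w \<in> S" for w
  proof -
    define e where "e = w * cauchy_transform M w - 1"
    have Imw: "Im w > 0" "Im w > y" using w SU by (auto simp: S_def)
    have "norm e \<le> (1 + c) * tail_integral (Im w)"
      unfolding e_def using w Imw by (intro norm_mult_cauchy_transform_minus_1) (auto simp: S_def)
    moreover have t: "(1 + c) * tail_integral (Im w) \<le> r / 4"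
    proof -
      have "(1 + c) * tail_integral (Im w) \<le> (1 + c) * tail_integral y"
        using c y Imw by (intro mult_left_mono tail_integral_antimono) auto
      also have "\<dots> \<le> 3 * (1 + c)\<^sup>2 * tail_integral y"
        using c y tail_integral_nonneg[of y] by (intro mult_right_mono) (auto simp: power2_eq_square)
      finally show ?thesis using y by simp
    qed
    ultimately have e: "norm e \<le> (1 + c) * tail_integral (Im w)" "norm e \<le> 1/2" using r by auto
    show "2 * (1 + c) * tail_integral (Im w) \<le> r / 2" using t by (simp add: algebra_simps)
    have "1 + e \<noteq> 0"
    proof
      assume "1 + e = 0"
      then have "e = -1" by (simp add: add_eq_0_iff)
      then show False using e(2) by simp
    qed
    have w0: "w \<noteq> 0" using Imw by auto
    have "w - reciprocal_cauchy M w = w * (e / (1 + e))"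
      using w0 \<open>1 + e \<noteq> 0\<close> unfolding reciprocal_cauchy_def
      by (simp add: e_def field_simps)
    moreover have "norm (e / (1 + e)) \<le> 2 * norm e"
    proof -
      have "1/2 \<le> norm (1 + e)" using norm_triangle_ineq2[of 1 "- e"] e(2) by simp
      then show ?thesis using frac_le[of "norm e" "norm e" "1/2" "norm (1+e)"] by (simp add: norm_divide)
    qed
    ultimately have "norm (w - reciprocal_cauchy M w) \<le> norm w * (2 * norm e)"
      by (metis norm_mult mult_left_mono norm_ge_zero)
    also have "\<dots> \<le> norm w * (2 * ((1 + c) * tail_integral (Im w)))"
      using e(1) by (intro mult_left_mono) auto
    finally show "norm (w - reciprocal_cauchy M w) \<le> 2 * (1 + c) * tail_integral (Im w) * norm w"
      by (simp only: mult_ac)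
  qed
  define \<beta> where "\<beta> = 2 * y"
  have ball: "w \<in> S" if z: "z \<in> truncated_cone \<alpha> \<beta>" and w: "norm (w - z) \<le> r * norm z" for z w
  proof -
    have w': "norm (w - z) \<le> norm z / (2 * (1 + \<alpha>))" using w by (simp add: r_def)
    note tb = truncated_cone_ball[OF z a w']
    have "Im z > 2 * y" using z by (auto simp: truncated_cone_def \<beta>_def)
    then have "Im w > y" using tb(1) by simp
    moreover have "norm w < c * Im w" using tb(2) y \<open>Im w > y\<close> by (simp add: c_def algebra_simps)
    ultimately show ?thesis by (simp add: S_def)
  qed
  have ex: "\<exists>w\<in>S. reciprocal_cauchy M w = z \<and> norm (w - z) \<le> r * norm z"
    if z: "z \<in> truncated_cone \<alpha> \<beta>" for z
  proof -
    let ?B = "cball z (r * norm z)"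
    have BS: "?B \<subseteq> S" using ball[OF z] by (auto simp: dist_norm norm_minus_commute)
    \<comment> \<open>A fixed point of \<open>T\<close> solves F(w) = z, and T(w) - z = w - F(w) is
      the small error.\<close>
    define T where "T w = w - reciprocal_cauchy M w + z" for w
    have "continuous_on ?B T"
      unfolding T_def[abs_def] using BS SU
      by (intro continuous_intros holomorphic_on_imp_continuous_on
          holomorphic_on_subset[OF holomorphic_reciprocal_cauchy]) auto
    moreover have "T ` ?B \<subseteq> ?B"
    proof clarify
      fix w assume w: "w \<in> ?B"
      then have wS: "w \<in> S" using BS by auto
      have "norm (w - z) \<le> norm z / (2 * (1 + \<alpha>))"
        using w by (simp add: r_def dist_norm norm_minus_commute)
      then have nw: "norm w \<le> 2 * norm z" using truncated_cone_ball(3)[OF z a] by blast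
      have "norm (T w - z) = norm (w - reciprocal_cauchy M w)" by (simp add: T_def)
      also have "\<dots> \<le> 2 * (1 + c) * tail_integral (Im w) * norm w" by (rule F_near[OF wS])
      also have "\<dots> \<le> r / 2 * (2 * norm z)" using F_near(2)[OF wS] nw r by (intro mult_mono) auto
      finally show "T w \<in> ?B" by (simp add: dist_norm norm_minus_commute)
    qed
    moreover have "compact ?B" "convex ?B" "?B \<noteq> {}" using r by (auto simp: mult_less_0_iff)
    ultimately obtain w where "w \<in> ?B" "T w = w" using brouwer[of ?B T] by blast
    then show ?thesis using BS by (intro bexI[of _ w]) (auto simp: T_def dist_norm norm_minus_commute)
  qed
  have gz: "g z \<in> S" "reciprocal_cauchy M (g z) = z" "norm (g z - z) \<le> r * norm z"
    if z: "z \<in> truncated_cone \<alpha> \<beta>" for z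
    using ex[OF z] g(2) by auto
  have "is_right_inverse_on M \<alpha> \<beta> g"
    unfolding is_right_inverse_on_def
  proof (intro conjI ballI)
    have "truncated_cone \<alpha> \<beta> \<subseteq> reciprocal_cauchy M ` S" using ex by blast
    then have "g holomorphic_on truncated_cone \<alpha> \<beta>" using g(1) holomorphic_on_subset by blast
    then show "g analytic_on truncated_cone \<alpha> \<beta>"
      using analytic_on_open[OF open_truncated_cone] by blast
    show "g ` truncated_cone \<alpha> \<beta> \<subseteq> upper_half_plane" using gz(1) SU by auto
    show "reciprocal_cauchy M (g z) = z" if "z \<in> truncated_cone \<alpha> \<beta>" for z using gz(2)[OF that] .
    let ?F = "inf at_infinity (principal (truncated_cone \<alpha> \<beta>))"
    have "((\<lambda>z. g z / z - 1) \<longlongrightarrow> 0) ?F"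
    proof (rule Lim_null_comparison)
      \<comment> \<open>The limit is taken in |z|, so Im (g z) is bounded below by a fixed multiple
        of |z|, as the cone allows.\<close>
      have "norm (g z / z - 1) \<le> 4 * (1 + c) * tail_integral (norm z / (2 * (1 + \<alpha>)))"
        if z: "z \<in> truncated_cone \<alpha> \<beta>" for z
      proof -
        have z0: "z \<noteq> 0" "Im z > 0" using z by (auto simp: truncated_cone_def)
        have gn: "norm (g z - z) \<le> norm z / (2 * (1 + \<alpha>))" using gz(3)[OF z] by (simp add: r_def)
        note tb = truncated_cone_ball[OF z a gn]
        have "norm (g z - z) \<le> 2 * (1 + c) * tail_integral (Im (g z)) * norm (g z)"
          using F_near(1)[OF gz(1)[OF z]] gz(2)[OF z] by simp
        also have "\<dots> \<le> 2 * (1 + c) * tail_integral (norm z / (2 * (1 + \<alpha>))) * (2 * norm z)"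
        proof (intro mult_mono mult_left_mono tail_integral_antimono mult_nonneg_nonneg tail_integral_nonneg)
          show "0 < norm z / (2 * (1 + \<alpha>))" using z0 a by auto
          then show "0 < norm z / (2 * (1 + \<alpha>))" .
          have "norm z / (2 * (1 + \<alpha>)) = (norm z / (1 + \<alpha>)) / 2" by (simp add: field_simps)
          also have "\<dots> \<le> Im z / 2" by (rule divide_right_mono[OF tb(4)]) simp
          finally show "norm z / (2 * (1 + \<alpha>)) \<le> Im (g z)" using tb(1) by (rule order_trans)
        qed (use tb c z0 in auto)
        finally have "norm (g z - z) / norm z \<le>
            2 * (1 + c) * tail_integral (norm z / (2 * (1 + \<alpha>))) * (2 * norm z) / norm z"
          by (rule divide_right_mono) simp
        also have "\<dots> = 4 * (1 + c) * tail_integral (norm z / (2 * (1 + \<alpha>)))"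
          using z0 by simp
        also have "norm (g z - z) / norm z = norm (g z / z - 1)"
          using z0 by (simp add: diff_divide_distrib flip: norm_divide)
        finally show ?thesis .
      qed
      then show "\<forall>\<^sub>F z in ?F. norm (g z / z - 1) \<le> 4 * (1 + c) * tail_integral (norm z / (2 * (1 + \<alpha>)))"
        by (auto simp: eventually_inf_principal)
      have "filterlim (\<lambda>z::complex. (1 / (2 * (1 + \<alpha>))) * norm z) at_top at_infinity"
        using a by (intro filterlim_tendsto_pos_mult_at_top[OF tendsto_const] filterlim_norm_at_top) auto
      then have "filterlim (\<lambda>z::complex. norm z / (2 * (1 + \<alpha>))) at_top at_infinity" by simp
      then have "((\<lambda>z::complex. 4 * (1 + c) * tail_integral (norm z / (2 * (1 + \<alpha>)))) \<longlongrightarrow> 4 * (1 + c) * 0) at_infinity"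
        by (intro tendsto_intros filterlim_compose[OF tail_integral_tendsto])
      then show "((\<lambda>z::complex. 4 * (1 + c) * tail_integral (norm z / (2 * (1 + \<alpha>)))) \<longlongrightarrow> 0) ?F"
        by (simp add: tendsto_mono[OF inf_le1])
    qed
    then show "((\<lambda>z. g z / z) \<longlongrightarrow> 1) ?F" by (rule LIM_zero_cancel)
  qed
  moreover have "\<beta> > 0" using y by (simp add: \<beta>_def)
  ultimately show ?thesis using that by blast
qed

text \<open>The normalisation puts both values in the disc about z once |z| is large, hence in a
  region where the Cauchy transform is injective. Raising the lower edge of the cone makes |z|
  large, since |z| >= Im z.\<close>

lemma right_inverse_eventually_unique:
  assumes a: "\<alpha> > 0" and "is_right_inverse_on M \<alpha> \<beta> g" "is_right_inverse_on M \<alpha> \<beta> h"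
  obtains \<beta>' where "\<beta>' \<ge> \<beta>" "\<And>z. z \<in> truncated_cone \<alpha> \<beta>' \<Longrightarrow> g z = h z"
proof -
  define c where "c = 4 * (1 + \<alpha>) + 1"
  have c: "c > 0" using a by (auto simp: c_def)
  obtain y where y: "y > 0" "3 * (1 + c)\<^sup>2 * tail_integral y < 1"
    using exists_small_tail[of 1 "3 * (1 + c)\<^sup>2"] by auto
  define S where "S = {z. norm z < c * Im z \<and> Im z > y}"
  have inj: "inj_on (cauchy_transform M) S"
    unfolding S_def using c y by (intro inj_on_cauchy_transform) auto
  obtain b1 where b1: "\<forall>z\<in>truncated_cone \<alpha> \<beta>. norm z \<ge> b1 \<longrightarrow> norm (g z - z) \<le> norm z / (2 * (1 + \<alpha>))"
    by (rule right_inverse_near[OF a assms(2)]) (rule that, blast)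
  obtain b2 where b2: "\<forall>z\<in>truncated_cone \<alpha> \<beta>. norm z \<ge> b2 \<longrightarrow> norm (h z - z) \<le> norm z / (2 * (1 + \<alpha>))"
    by (rule right_inverse_near[OF a assms(3)]) (rule that, blast)
  define \<beta>' where "\<beta>' = max (max \<beta> (2 * y)) (max b1 b2)"
  have "g z = h z" if z: "z \<in> truncated_cone \<alpha> \<beta>'" for z
  proof -
    have z': "z \<in> truncated_cone \<alpha> \<beta>" using z by (auto simp: truncated_cone_def \<beta>'_def)
    have "Im z > \<beta>'" using z by (auto simp: truncated_cone_def)
    then have Imz: "Im z > 2 * y" "norm z \<ge> b1" "norm z \<ge> b2"
      using abs_Im_le_cmod[of z] by (auto simp: \<beta>'_def)
    have inS: "w \<in> S" if "norm (w - z) \<le> norm z / (2 * (1 + \<alpha>))" for w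
    proof -
      note tb = truncated_cone_ball[OF z a that]
      have "Im w > y" using tb(1) Imz by simp
      then show ?thesis using tb(2) y by (simp add: c_def S_def algebra_simps)
    qed
    have "g z \<in> S" "h z \<in> S" using inS b1 b2 Imz z' by auto
    moreover have "reciprocal_cauchy M (g z) = reciprocal_cauchy M (h z)"
      using assms(2,3) z' by (simp add: is_right_inverse_on_def)
    ultimately show ?thesis using inj by (auto simp: inj_on_def reciprocal_cauchy_def)
  qed
  then show ?thesis using that[of \<beta>'] by (auto simp: \<beta>'_def)
qed

end

text \<open>Both reciprocal transforms invert g on its image, which is open because g is holomorphic
  and injective on the open cone. The identity theorem extends the equality to the
  half-plane.\<close>

lemma cauchy_transform_eq_if_common_right_inverse:
  assumes "real_distribution M" "real_distribution N" "\<alpha> > 0"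
    and g: "is_right_inverse_on M \<alpha> \<beta> g" and h: "is_right_inverse_on N \<alpha> \<beta> g" and z: "Im z > 0"
  shows "cauchy_transform M z = cauchy_transform N z"
proof -
  interpret M: real_distribution M by fact
  interpret N: real_distribution N by fact
  let ?C = "truncated_cone \<alpha> \<beta>"
  have "g holomorphic_on ?C"
    using g analytic_imp_holomorphic by (auto simp: is_right_inverse_on_def)
  moreover have "inj_on g ?C"
    using g by (intro inj_on_inverseI[where g = "reciprocal_cauchy M"]) (auto simp: is_right_inverse_on_def)
  ultimately have op: "open (g ` ?C)" by (intro open_mapping_thm3 open_truncated_cone)
  have sub: "g ` ?C \<subseteq> upper_half_plane" using g by (simp add: is_right_inverse_on_def)
  have eq: "cauchy_transform M w = cauchy_transform N w" if "w \<in> g ` ?C" for w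
  proof -
    have "reciprocal_cauchy M w = reciprocal_cauchy N w"
      using that g h by (auto simp: is_right_inverse_on_def)
    \<comment> \<open>With 1 / 0 = 0 inversion is an involution, so no case distinction at zeros
      arises.\<close>
    then show ?thesis by (metis reciprocal_cauchy_def div_by_1 divide_divide_eq_right mult_1)
  qed
  show ?thesis
    using analytic_continuation_open[OF op open_upper_half_plane _ convex_connected[OF convex_upper_half_plane]
        sub M.holomorphic_cauchy_transform N.holomorphic_cauchy_transform eq]
      truncated_cone_nonempty[OF \<open>\<alpha> > 0\<close>] z by auto
qed

section \<open>Injectivity of the Cauchy transform\<close>

lemma abs_arctan_diff_le: "\<bar>arctan a - arctan b\<bar> \<le> \<bar>a - b\<bar>"
proof -
  have *: "norm (arctan b - arctan a) \<le> 1 * norm (b - a)"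
  proof (rule field_differentiable_bound[of UNIV arctan "\<lambda>x. inverse (1 + x\<^sup>2)"])
    show "(arctan has_field_derivative inverse (1 + x\<^sup>2)) (at x within UNIV)" for x
      using DERIV_arctan[of x] by simp
    show "norm (inverse (1 + x\<^sup>2)) \<le> 1" for x :: real
      by (simp add: divide_simps abs_if add_nonneg_nonneg power2_eq_square[symmetric] add_pos_nonneg inverse_eq_divide)
  qed auto
  then show ?thesis by (simp add: abs_minus_commute)
qed

context real_distribution
begin

text \<open>For y > 0, 1/2 plus this value divided by pi is the distribution function of M smoothed
  by a Cauchy law of width y. It is a primitive in x of - Im G(x + i y) and avoids integrating Im G
  over intervals.\<close>

definition arctan_integral :: "real \<Rightarrow> real \<Rightarrow> real" where
  "arctan_integral x y = (\<integral>s. arctan ((x - s) / y) \<partial>M)"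

lemma abs_arctan_le: "\<bar>arctan u\<bar> \<le> pi / 2"
  using arctan_bounded[of u] by (auto simp: abs_le_iff)

lemma integrable_arctan: "integrable M (\<lambda>s. arctan ((x - s) / y))"
  using abs_arctan_le by (intro integrable_bounded[where B = "pi / 2"]) auto

lemma arctan_integral_deriv:
  assumes y: "y > 0"
  shows "((\<lambda>x. arctan_integral x y) has_field_derivative - Im (cauchy_transform M (Complex x y))) (at x)"
proof -
  have "(\<lambda>h. (arctan_integral (x + h) y - arctan_integral x y) / h)
      \<midarrow>0\<rightarrow> (\<integral>s. y * (1 / (norm (Complex x y - complex_of_real s))\<^sup>2) \<partial>M)"
    unfolding tendsto_at_iff_sequentially o_def
  proof (intro allI impI)
    fix X assume X: "\<forall>i. X i \<in> UNIV - {0::real}" "X \<longlonglongrightarrow> 0"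
    have "(\<lambda>n. \<integral>s. (arctan ((x + X n - s) / y) - arctan ((x - s) / y)) / X n \<partial>M) \<longlonglongrightarrow>
        (\<integral>s. y * (1 / (norm (Complex x y - complex_of_real s))\<^sup>2) \<partial>M)"
    \<comment> \<open>The Lipschitz bound for arctan dominates all difference quotients.\<close>
    proof (rule integral_dominated_convergence[where w = "\<lambda>_. 1 / y"])
      show "AE s in M. (\<lambda>n. (arctan ((x + X n - s) / y) - arctan ((x - s) / y)) / X n)
          \<longlonglongrightarrow> y * (1 / (norm (Complex x y - complex_of_real s))\<^sup>2)"
      proof (intro AE_I2)
        fix s
        have nrm: "(norm (Complex x y - complex_of_real s))\<^sup>2 = (x - s)\<^sup>2 + y\<^sup>2"
          by (simp add: cmod_power2)
        have "1 + ((x - s) / y)\<^sup>2 = ((x - s)\<^sup>2 + y\<^sup>2) / y\<^sup>2"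
          using y by (simp add: power_divide add_divide_distrib)
        then have "inverse (1 + ((x - s) / y)\<^sup>2) / y = y * (1 / ((x - s)\<^sup>2 + y\<^sup>2))"
          using y by (simp add: power2_eq_square)
        then have "((\<lambda>x. arctan ((x - s) / y)) has_field_derivative
            y * (1 / (norm (Complex x y - complex_of_real s))\<^sup>2)) (at x)"
          unfolding nrm using y by (auto intro!: derivative_eq_intros)
        then have "(\<lambda>h. (arctan ((x + h - s) / y) - arctan ((x - s) / y)) / h)
            \<midarrow>0\<rightarrow> y * (1 / (norm (Complex x y - complex_of_real s))\<^sup>2)"
          by (simp add: DERIV_def)
        then show "(\<lambda>n. (arctan ((x + X n - s) / y) - arctan ((x - s) / y)) / X n)
          \<longlonglongrightarrow> y * (1 / (norm (Complex x y - complex_of_real s))\<^sup>2)"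
          unfolding tendsto_at_iff_sequentially o_def using X by blast
      qed
      fix n
      have "norm ((arctan ((x + X n - s) / y) - arctan ((x - s) / y)) / X n) \<le> 1 / y" for s
      proof -
        have "\<bar>arctan ((x + X n - s) / y) - arctan ((x - s) / y)\<bar> \<le> \<bar>(x + X n - s) / y - (x - s) / y\<bar>"
          by (rule abs_arctan_diff_le)
        also have "\<dots> = \<bar>X n\<bar> / y" using y by (simp flip: diff_divide_distrib)
        finally show ?thesis using X(1) y by (auto simp: divide_simps mult_ac)
      qed
      then show "AE s in M. norm ((arctan ((x + X n - s) / y) - arctan ((x - s) / y)) / X n) \<le> 1 / y" by simp
    qed auto
    then show "(\<lambda>n. (arctan_integral (x + X n) y - arctan_integral x y) / X n) \<longlonglongrightarrow>
        (\<integral>s. y * (1 / (norm (Complex x y - complex_of_real s))\<^sup>2) \<partial>M)"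
      by (simp add: arctan_integral_def integrable_arctan)
  qed
  moreover have "(\<integral>s. y * (1 / (norm (Complex x y - complex_of_real s))\<^sup>2) \<partial>M) =
      - Im (cauchy_transform M (Complex x y))"
    using Im_cauchy_transform[of "Complex x y"] y by (subst integral_mult_right_zero) simp
  ultimately show ?thesis by (simp add: DERIV_def)
qed

text \<open>Supplies the constant of integration when two primitives of the same function are
  compared.\<close>

lemma arctan_integral_at_top:
  assumes "y > 0"
  shows "((\<lambda>x. arctan_integral x y) \<longlongrightarrow> pi / 2) at_top"
proof -
  have "((\<lambda>x. \<integral>s. arctan ((x - s) / y) \<partial>M) \<longlongrightarrow> (\<integral>s. pi / 2 \<partial>M)) at_top"
  proof (rule integral_dominated_convergence_at_top[where w = "\<lambda>_. pi / 2"])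
    show "AE s in M. ((\<lambda>x. arctan ((x - s) / y)) \<longlongrightarrow> pi / 2) at_top"
    proof (intro AE_I2)
      fix s
      have "filterlim (\<lambda>x. (1 / y) * (- s + x)) at_top at_top"
        using assms by (intro filterlim_tendsto_pos_mult_at_top[OF tendsto_const]
            filterlim_tendsto_add_at_top[OF tendsto_const] filterlim_ident) auto
      then have "filterlim (\<lambda>x. (x - s) / y) at_top at_top" by simp
      then show "((\<lambda>x. arctan ((x - s) / y)) \<longlongrightarrow> pi / 2) at_top"
        by (rule filterlim_compose[OF tendsto_arctan_at_top])
    qed
  qed (use abs_arctan_le in auto)
  then show ?thesis by (simp add: arctan_integral_def prob_space[simplified])
qed

text \<open>The shift 1/n dominates the width 1/n^2. So s = x falls on the left side in the limit,
  and the right-continuous \<open>cdf\<close> results instead of the mean of its one-sided limits at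
  an atom.\<close>

lemma arctan_integral_tendsto_cdf:
  "(\<lambda>n. arctan_integral (x + 1 / real (Suc n)) (1 / (real (Suc n))\<^sup>2)) \<longlonglongrightarrow> pi * cdf M x - pi / 2"
proof -
  let ?u = "\<lambda>n s. (x + 1 / real (Suc n) - s) / (1 / (real (Suc n))\<^sup>2)"
  have u: "?u n s = real (Suc n) * ((x - s) * real (Suc n) + 1)" for n s
    by (simp add: field_simps power2_eq_square)
  have lim: "filterlim (\<lambda>n. real (Suc n)) at_top sequentially"
    by (intro filterlim_compose[OF filterlim_real_sequentially] filterlim_Suc)
  have "(\<lambda>n. \<integral>s. arctan (?u n s) \<partial>M) \<longlonglongrightarrow> (\<integral>s. pi * indicator {..x} s - pi / 2 \<partial>M)"
  proof (rule integral_dominated_convergence[where w = "\<lambda>_. pi / 2"])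
    show "AE s in M. (\<lambda>n. arctan (?u n s)) \<longlonglongrightarrow> pi * indicator {..x} s - pi / 2"
    proof (intro AE_I2)
      fix s
      show "(\<lambda>n. arctan (?u n s)) \<longlonglongrightarrow> pi * indicator {..x} s - pi / 2"
      proof (cases "s \<le> x")
        case True
        have "filterlim (\<lambda>n. ?u n s) at_top sequentially"
        proof (rule filterlim_at_top_mono[OF lim])
          show "\<forall>\<^sub>F n in sequentially. real (Suc n) \<le> ?u n s"
            unfolding u using True mult_left_mono[of 1 "(x - s) * real (Suc n) + 1" "real (Suc n)" for n]
            by (intro always_eventually allI) (simp del: of_nat_Suc)
        qed
        then show ?thesis using True filterlim_compose[OF tendsto_arctan_at_top] by fastforce
      next
        case False
        have "filterlim (\<lambda>n. real (Suc n) * (1 + (x - s) * real (Suc n))) at_bot sequentially"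
        proof -
          have "filterlim (\<lambda>n. (s - x) * real (Suc n)) at_top sequentially"
            using False by (intro filterlim_tendsto_pos_mult_at_top[OF tendsto_const _ lim]) auto
          then have "filterlim (\<lambda>n. - 1 + (s - x) * real (Suc n)) at_top sequentially"
            by (rule filterlim_tendsto_add_at_top[OF tendsto_const])
          then have "filterlim (\<lambda>n. real (Suc n) * (- 1 + (s - x) * real (Suc n))) at_top sequentially"
            by (rule filterlim_at_top_mult_at_top[OF lim])
          then have "filterlim (\<lambda>n. - (real (Suc n) * (- 1 + (s - x) * real (Suc n)))) at_bot sequentially"
            by (simp add: filterlim_uminus_at_bot del: of_nat_Suc)
          then show ?thesis by (simp add: algebra_simps del: of_nat_Suc)
        qed
        then have "filterlim (\<lambda>n. ?u n s) at_bot sequentially" unfolding u by (simp add: add.commute del: of_nat_Suc)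
        then show ?thesis using False filterlim_compose[OF tendsto_arctan_at_bot] by fastforce
      qed
    qed
  qed (use abs_arctan_le in auto)
  moreover have "integrable M (indicat_real {..x})"
    by (intro integrable_bounded[where B = 1]) (auto simp: indicator_def)
  then have "(\<integral>s. pi * indicator {..x} s - pi / 2 \<partial>M) = pi * cdf M x - pi / 2"
    by (subst Bochner_Integration.integral_diff) (auto simp: prob_space[simplified] cdf_def)
  ultimately show ?thesis by (simp add: arctan_integral_def)
qed

end

text \<open>Equal transforms give smoothed distribution functions with equal derivatives; equal
  limits at infinity remove the constant, and shrinking the width recovers the
  \<open>cdf\<close>.\<close>

theorem real_distribution_eqI_cauchy_transform:
  assumes "real_distribution M" "real_distribution N"
    and eq: "\<And>z. Im z > 0 \<Longrightarrow> cauchy_transform M z = cauchy_transform N z"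
  shows "M = N"
proof -
  interpret M: real_distribution M by fact
  interpret N: real_distribution N by fact
  have "M.arctan_integral x y = N.arctan_integral x y" if y: "y > 0" for x y
  proof -
    let ?D = "\<lambda>x. M.arctan_integral x y - N.arctan_integral x y"
    have "(?D has_field_derivative 0) (at x)" for x
      using DERIV_diff[OF M.arctan_integral_deriv[OF y, of x] N.arctan_integral_deriv[OF y, of x]]
        eq[of "Complex x y"] y by simp
    then have const: "?D x' = ?D x" for x' using DERIV_isconst_all by blast
    have "(?D \<longlongrightarrow> pi / 2 - pi / 2) at_top"
      by (intro tendsto_diff M.arctan_integral_at_top N.arctan_integral_at_top y)
    moreover have "?D = (\<lambda>_. ?D x)" using const by blast
    ultimately have "((\<lambda>_. ?D x) \<longlongrightarrow> 0) (at_top :: real filter)" by (metis diff_self)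
    then show ?thesis by (simp add: tendsto_const_iff)
  qed
  then have "pi * cdf M x - pi / 2 = pi * cdf N x - pi / 2" for x
    using LIMSEQ_unique[OF M.arctan_integral_tendsto_cdf[of x]] N.arctan_integral_tendsto_cdf[of x] by simp
  then have "cdf M = cdf N" by auto
  then show ?thesis using assms cdf_unique by blast
qed

section \<open>The subordination function\<close>

context real_distribution
begin

definition subordination :: "real \<Rightarrow> complex \<Rightarrow> complex" where
  "subordination t z = (THE w. Im w > 0 \<and> w + complex_of_real t * cauchy_transform M w = z)"

lemma subordination_unique:
  assumes t: "t > 0" and z: "Im z > 0"
    and v: "Im v > 0" "v + complex_of_real t * cauchy_transform M v = z"
    and w: "Im w > 0" "w + complex_of_real t * cauchy_transform M w = z"
  shows "v = w"
proof (rule ccontr)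
  assume "v \<noteq> w"
  \<comment> \<open>Read off from Im u + t Im G(u) = Im z > 0.\<close>
  have ratio: "- Im (cauchy_transform M u) / Im u < 1 / t"
    if u: "Im u > 0" "u + complex_of_real t * cauchy_transform M u = z" for u
  proof -
    have "Im u + t * Im (cauchy_transform M u) > 0" using arg_cong[OF u(2), of Im] z by simp
    then show ?thesis using t u by (simp add: field_simps)
  qed
  have "v - w + complex_of_real t * (cauchy_transform M v - cauchy_transform M w) = 0"
    using v(2) w(2) by (simp add: algebra_simps)
  then have "(v - w) * (1 - complex_of_real t * resolvent_integral M v w) = 0"
    unfolding cauchy_transform_diff[OF v(1) w(1)] by (simp add: algebra_simps)
  then have "complex_of_real t * resolvent_integral M v w = 1" using \<open>v \<noteq> w\<close> by simp
  then have "t * norm (resolvent_integral M v w) = 1"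
    using t by (metis abs_of_pos norm_mult norm_of_real norm_one)
  moreover have "norm (resolvent_integral M v w) < 1 / t"
    using norm_resolvent_integral_le[OF v(1) w(1)] ratio[OF v] ratio[OF w] by simp
  ultimately show False using t by (simp add: field_simps)
qed

lemma subordination_exists:
  assumes t: "t > 0" and z: "Im z > 0"
  shows "\<exists>w. Im w > 0 \<and> w + complex_of_real t * cauchy_transform M w = z"
proof -
  \<comment> \<open>\<open>T\<close> preserves this set: since Im G < 0 it does not lower the height
    below Im z, and at such heights t |G| <= t / Im z. The half-plane also keeps G away from its
    boundary.\<close>
  let ?B = "cball z (t / Im z) \<inter> {w. Im w \<ge> Im z}"
  define T where "T w = z - complex_of_real t * cauchy_transform M w" for w
  have B: "compact ?B" by (intro compact_Int_closed compact_cball closed_halfspace_Im_ge)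
  have "convex ?B" by (intro convex_Int convex_cball convex_halfspace_Im_ge)
  have "z \<in> ?B" using t z by auto
  then have "?B \<noteq> {}" by blast
  have "continuous_on ?B T"
    unfolding T_def[abs_def] using z
    by (intro continuous_intros holomorphic_on_imp_continuous_on
        holomorphic_on_subset[OF holomorphic_cauchy_transform]) auto
  have TB: "T w \<in> ?B" if "w \<in> ?B" for w
  proof -
    have w: "w \<in> cball z (t / Im z)" "Im z \<le> Im w" using that by auto
    have "norm (T w - z) = t * norm (cauchy_transform M w)" using t by (simp add: T_def norm_mult)
    also have "norm (cauchy_transform M w) \<le> 1 / Im w" using w z by (intro norm_cauchy_transform_le) auto
    also have "1 / Im w \<le> 1 / Im z" using w z by (intro divide_left_mono) auto
    finally have "norm (T w - z) \<le> t / Im z" using t by simp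
    moreover have "Im (T w) \<ge> Im z"
      using Im_cauchy_transform_neg[of w] w z t by (simp add: T_def mult_nonneg_nonpos)
    ultimately show "T w \<in> ?B" by (simp add: dist_norm norm_minus_commute)
  qed
  have "T \<in> ?B \<rightarrow> ?B" using TB by blast
  then obtain w where "w \<in> ?B" "T w = w"
    by (rule brouwer[OF B \<open>convex ?B\<close> \<open>?B \<noteq> {}\<close> \<open>continuous_on ?B T\<close>])
  then show ?thesis using z by (intro exI[of _ w]) (auto simp: T_def algebra_simps)
qed

context
  fixes t :: real
  assumes t: "t > 0"
begin

lemma
  assumes z: "Im z > 0"
  shows Im_subordination_pos: "Im (subordination t z) > 0"
    and subordination_eq: "subordination t z + complex_of_real t * cauchy_transform M (subordination t z) = z"
proof -
  have "\<exists>!w. Im w > 0 \<and> w + complex_of_real t * cauchy_transform M w = z"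
    using subordination_exists[OF t z] subordination_unique[OF t z] by blast
  from theI'[OF this] show "Im (subordination t z) > 0"
    "subordination t z + complex_of_real t * cauchy_transform M (subordination t z) = z"
    unfolding subordination_def[symmetric] by simp_all
qed

text \<open>The map w + t G(w) need not stay in the upper half-plane, so the second assumption
  selects the part on which it is inverted.\<close>

lemma subordination_left_inverse:
  assumes "Im w > 0" "Im (w + complex_of_real t * cauchy_transform M w) > 0"
  shows "subordination t (w + complex_of_real t * cauchy_transform M w) = w"
  using subordination_unique[OF t assms(2) Im_subordination_pos[OF assms(2)] subordination_eq[OF assms(2)] assms(1)] by simp

lemma Im_subordination_ge:
  assumes z: "Im z > 0"
  shows "Im z \<le> Im (subordination t z)"
proof -
  have "Im z = Im (subordination t z) + t * Im (cauchy_transform M (subordination t z))"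
    using arg_cong[OF subordination_eq[OF z], of Im] by simp
  then show ?thesis
    using Im_cauchy_transform_neg[OF Im_subordination_pos[OF z]] t by (simp add: mult_nonneg_nonpos)
qed

lemma norm_subordination_diff_le:
  assumes z: "Im z > 0"
  shows "norm (subordination t z - z) \<le> t / Im z"
proof -
  have "subordination t z - z = - complex_of_real t * cauchy_transform M (subordination t z)"
    using subordination_eq[OF z] by (simp add: algebra_simps add_eq_0_iff2)
  then have "norm (subordination t z - z) = t * norm (cauchy_transform M (subordination t z))"
    using t by (simp add: norm_mult)
  also have "\<dots> \<le> t * (1 / Im (subordination t z))"
    using t by (intro mult_left_mono norm_cauchy_transform_le Im_subordination_pos z) auto
  also have "\<dots> \<le> t * (1 / Im z)"
    using Im_subordination_ge[OF z] z t by (intro mult_left_mono divide_left_mono) auto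
  finally show ?thesis by simp
qed

text \<open>On the preimage \<open>S\<close> of the half-plane, w + t G(w) is injective, having
  \<omega> as left inverse, and it maps \<open>S\<close> onto the half-plane. So \<omega> is the
  inverse of an injective holomorphic map.\<close>

lemma holomorphic_subordination: "subordination t holomorphic_on upper_half_plane"
proof -
  let ?H = "\<lambda>w. w + complex_of_real t * cauchy_transform M w"
  define S where "S = upper_half_plane \<inter> ?H -` upper_half_plane"
  have holH: "?H holomorphic_on upper_half_plane"
    by (intro holomorphic_intros holomorphic_cauchy_transform)
  have opS: "open S"
    unfolding S_def
    by (intro continuous_open_preimage holomorphic_on_imp_continuous_on holH open_upper_half_plane)
  have inv: "subordination t (?H w) = w" if "w \<in> S" for w
    using that subordination_left_inverse by (auto simp: S_def)
  have injS: "inj_on ?H S" using inv by (rule inj_on_inverseI)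
  have holS: "?H holomorphic_on S" by (rule holomorphic_on_subset[OF holH]) (auto simp: S_def)
  obtain g where g: "g holomorphic_on (?H ` S)" "\<And>w. w \<in> S \<Longrightarrow> g (?H w) = w"
    by (rule holomorphic_has_inverse[OF holS opS injS]) (rule that)
  have im: "?H ` S = upper_half_plane"
  proof (intro equalityI subsetI)
    fix z assume "z \<in> upper_half_plane"
    then have z: "Im z > 0" by simp
    have "subordination t z \<in> S"
      using Im_subordination_pos[OF z] subordination_eq[OF z] z by (simp add: S_def)
    then show "z \<in> ?H ` S" using image_eqI[of z ?H "subordination t z" S] subordination_eq[OF z] by simp
  qed (auto simp: S_def)
  have geq: "g z = subordination t z" if "z \<in> upper_half_plane" for z
  proof -
    obtain w where "w \<in> S" "z = ?H w" using \<open>z \<in> upper_half_plane\<close> unfolding im[symmetric] by blast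
    then show ?thesis using g(2)[of w] inv[of w] by simp
  qed
  have "g holomorphic_on upper_half_plane" using g(1) unfolding im .
  then show ?thesis using geq by (rule holomorphic_transform)
qed

lemma subordination_div_tendsto:
  "((\<lambda>y. subordination t (Complex 0 y) / Complex 0 y) \<longlongrightarrow> 1) at_top"
proof -
  have "((\<lambda>y. subordination t (Complex 0 y) / Complex 0 y - 1) \<longlongrightarrow> 0) at_top"
  proof (rule Lim_null_comparison)
    show "\<forall>\<^sub>F y in at_top. norm (subordination t (Complex 0 y) / Complex 0 y - 1) \<le> t / y / y"
      using eventually_gt_at_top[of 0]
    proof eventually_elim
      fix y :: real assume y: "y > 0"
      then have nz: "Complex 0 y \<noteq> 0" "norm (Complex 0 y) = y" by (auto simp: complex_eq_iff cmod_def)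
      have "subordination t (Complex 0 y) / Complex 0 y - 1 = (subordination t (Complex 0 y) - Complex 0 y) / Complex 0 y"
        using nz by (simp add: diff_divide_distrib)
      then have "norm (subordination t (Complex 0 y) / Complex 0 y - 1) =
          norm (subordination t (Complex 0 y) - Complex 0 y) / y"
        by (simp add: norm_divide nz(2))
      also have "\<dots> \<le> t / y / y"
        using norm_subordination_diff_le[of "Complex 0 y"] y by (intro divide_right_mono) auto
      finally show "norm (subordination t (Complex 0 y) / Complex 0 y - 1) \<le> t / y / y" .
    qed
    show "((\<lambda>y. t / y / y) \<longlongrightarrow> 0) at_top"
    proof -
      have "((\<lambda>y. k / y) \<longlongrightarrow> 0) at_top" for k :: real
        by (intro tendsto_divide_0[OF tendsto_const] filterlim_at_top_imp_at_infinity filterlim_ident)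
      from tendsto_mult[OF this[of t] this[of 1]] show ?thesis by simp
    qed
  qed
  then show ?thesis by (rule LIM_zero_cancel)
qed

end

text \<open>Composition with \<omega> preserves the normalisation that encodes total mass 1.\<close>

lemma cauchy_transform_along_imaginary:
  fixes \<omega> :: "complex \<Rightarrow> complex"
  assumes \<omega>: "((\<lambda>y. \<omega> (Complex 0 y) / Complex 0 y) \<longlongrightarrow> 1) at_top"
    and Im\<omega>: "\<And>y. y > 0 \<Longrightarrow> Im (\<omega> (Complex 0 y)) \<ge> y"
  shows "((\<lambda>y. Complex 0 y * cauchy_transform M (\<omega> (Complex 0 y))) \<longlongrightarrow> 1) at_top"
proof -
  have "((\<lambda>y. \<omega> (Complex 0 y) * cauchy_transform M (\<omega> (Complex 0 y)) - 1) \<longlongrightarrow> 0) at_top"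
  proof (rule Lim_null_comparison)
    have "\<forall>\<^sub>F y in at_top. dist (\<omega> (Complex 0 y) / Complex 0 y) 1 < 1"
      by (rule tendstoD[OF \<omega>]) simp
    then show "\<forall>\<^sub>F y in at_top. norm (\<omega> (Complex 0 y) * cauchy_transform M (\<omega> (Complex 0 y)) - 1) \<le> (1 + 2) * tail_integral y"
      using eventually_gt_at_top[of 0]
    proof eventually_elim
      fix y :: real assume y: "y > 0" and d: "dist (\<omega> (Complex 0 y) / Complex 0 y) 1 < 1"
      let ?w = "\<omega> (Complex 0 y)"
      have ny: "norm (Complex 0 y) = y" using y by (simp add: cmod_def)
      have "norm (?w / Complex 0 y) \<le> norm (?w / Complex 0 y - 1) + 1"
        using norm_triangle_ineq[of "?w / Complex 0 y - 1" 1] by simp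
      then have "norm ?w / y \<le> 2" using d by (simp add: dist_norm norm_divide ny)
      then have "norm ?w \<le> 2 * y" using y by (simp add: divide_simps)
      \<comment> \<open>The aperture 2 at \<open>?w\<close> is the source of the constant
        \<open>1 + 2\<close>.\<close>
      then have nw: "norm ?w \<le> 2 * Im ?w" using Im\<omega>[OF y] by simp
      have Imw: "Im ?w > 0" using Im\<omega>[OF y] y by simp
      have "norm (?w * cauchy_transform M ?w - 1) \<le> (1 + 2) * tail_integral (Im ?w)"
        by (rule norm_mult_cauchy_transform_minus_1[OF Imw nw])
      also have "\<dots> \<le> (1 + 2) * tail_integral y"
        using y Im\<omega>[OF y] by (intro mult_left_mono tail_integral_antimono) auto
      finally show "norm (?w * cauchy_transform M ?w - 1) \<le> (1 + 2) * tail_integral y" .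
    qed
    show "((\<lambda>y. (1 + 2) * tail_integral y) \<longlongrightarrow> 0) at_top"
      using tendsto_mult[OF tendsto_const tail_integral_tendsto, of "1 + 2"] by simp
  qed
  then have "((\<lambda>y. \<omega> (Complex 0 y) * cauchy_transform M (\<omega> (Complex 0 y))) \<longlongrightarrow> 1) at_top"
    by (rule LIM_zero_cancel)
  then have "((\<lambda>y. \<omega> (Complex 0 y) * cauchy_transform M (\<omega> (Complex 0 y)) / (\<omega> (Complex 0 y) / Complex 0 y)) \<longlongrightarrow> 1 / 1) at_top"
    by (intro tendsto_divide \<omega>) auto
  then have "((\<lambda>y. \<omega> (Complex 0 y) * cauchy_transform M (\<omega> (Complex 0 y)) / (\<omega> (Complex 0 y) / Complex 0 y)) \<longlongrightarrow> 1) at_top"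
    by simp
  then show ?thesis
  proof (rule Lim_transform_eventually)
    show "\<forall>\<^sub>F y in at_top. \<omega> (Complex 0 y) * cauchy_transform M (\<omega> (Complex 0 y)) / (\<omega> (Complex 0 y) / Complex 0 y) =
        Complex 0 y * cauchy_transform M (\<omega> (Complex 0 y))"
      using eventually_gt_at_top[of 0]
    proof eventually_elim
      fix y :: real assume "y > 0"
      then have "\<omega> (Complex 0 y) \<noteq> 0" "Complex 0 y \<noteq> 0" using Im\<omega>[of y] by (auto simp: complex_eq_iff)
      then show "\<omega> (Complex 0 y) * cauchy_transform M (\<omega> (Complex 0 y)) / (\<omega> (Complex 0 y) / Complex 0 y) =
        Complex 0 y * cauchy_transform M (\<omega> (Complex 0 y))" by simp
    qed
  qed
qed

end

section \<open>The semicircle law\<close>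

text \<open>The substitution x = 2 sqrt t sin \<theta> turns sqrt (4 t - x^2) dx into 4 t cos^2
  \<theta> d\<theta>, whose product with K is integrated by \<Phi>.\<close>

lemma has_integral_sqrt_arcsin_substitution:
  fixes K :: "real \<Rightarrow> complex" and \<Phi> :: "real \<Rightarrow> complex"
  assumes t: "t > 0"
    and der: "\<And>\<theta>. (\<Phi> has_vector_derivative complex_of_real ((cos \<theta>)\<^sup>2) * K (sin \<theta>)) (at \<theta>)"
  shows "((\<lambda>x. complex_of_real (sqrt (4 * t - x\<^sup>2)) * K (x / (2 * sqrt t))) has_integral
    complex_of_real (4 * t) * (\<Phi> (pi / 2) - \<Phi> (- pi / 2))) {- 2 * sqrt t .. 2 * sqrt t}"
proof -
  define r where "r = sqrt t"
  have r: "r > 0" "t = r\<^sup>2" using t by (auto simp: r_def)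
  let ?F = "\<lambda>x. complex_of_real (4 * t) * \<Phi> (arcsin (x / (2 * r)))"
  have "((\<lambda>x. complex_of_real (sqrt (4 * t - x\<^sup>2)) * K (x / (2 * r))) has_integral ?F (2 * r) - ?F (- 2 * r)) {- 2 * r .. 2 * r}"
  \<comment> \<open>\<open>arcsin\<close> is only continuous at the end points, so derivatives are
    taken in the interior.\<close>
  proof (rule fundamental_theorem_of_calculus_interior)
    show "- 2 * r \<le> 2 * r" using r by simp
    have "continuous_on UNIV \<Phi>"
      using der by (intro continuous_at_imp_continuous_on ballI has_vector_derivative_continuous)
    moreover have "continuous_on {- 2 * r .. 2 * r} (\<lambda>x. arcsin (x / (2 * r)))"
      using r by (intro continuous_on_arcsin continuous_intros) (auto simp: divide_simps)
    ultimately have "continuous_on {- 2 * r .. 2 * r} (\<lambda>x. \<Phi> (arcsin (x / (2 * r))))"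
      by (rule continuous_on_compose2) auto
    then show "continuous_on {- 2 * r .. 2 * r} ?F" by (intro continuous_intros)
    fix x assume x: "x \<in> {- 2 * r <..< 2 * r}"
    define u where "u = x / (2 * r)"
    have u: "- 1 < u" "u < 1" using x r by (auto simp: u_def divide_simps)
    have u2: "u\<^sup>2 < 1" using u by (simp add: abs_square_less_1)
    define q where "q = sqrt (1 - u\<^sup>2)"
    have q: "q > 0" "q\<^sup>2 = 1 - u\<^sup>2" using u2 by (auto simp: q_def)
    have "((\<lambda>x. arcsin (x / (2 * r))) has_real_derivative inverse q * (1 / (2 * r))) (at x)"
      using u r by (auto intro!: derivative_eq_intros simp: u_def[symmetric] q_def)
    then have "((\<lambda>x. arcsin (x / (2 * r))) has_vector_derivative inverse q * (1 / (2 * r))) (at x)"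
      by (simp add: has_real_derivative_iff_has_vector_derivative)
    then have "(\<Phi> \<circ> (\<lambda>x. arcsin (x / (2 * r))) has_vector_derivative
        (inverse q * (1 / (2 * r))) *\<^sub>R (complex_of_real ((cos (arcsin u))\<^sup>2) * K (sin (arcsin u)))) (at x)"
      using der by (intro vector_diff_chain_at) (auto simp: u_def)
    then have "(?F has_vector_derivative complex_of_real (4 * t) *
        ((inverse q * (1 / (2 * r))) *\<^sub>R (complex_of_real ((cos (arcsin u))\<^sup>2) * K (sin (arcsin u))))) (at x)"
      unfolding o_def by (rule has_vector_derivative_mult_right)
    also have "complex_of_real (4 * t) *
        ((inverse q * (1 / (2 * r))) *\<^sub>R (complex_of_real ((cos (arcsin u))\<^sup>2) * K (sin (arcsin u)))) =
        complex_of_real (4 * t * (inverse q * (1 / (2 * r))) * q\<^sup>2) * K u"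
      using u u2 by (simp add: cos_arcsin q_def scaleR_conv_of_real)
    also have "4 * t * (inverse q * (1 / (2 * r))) * q\<^sup>2 = 2 * r * q"
      using q(1) r by (simp add: field_simps power2_eq_square)
    also have "2 * r * q = sqrt (4 * t - x\<^sup>2)"
    proof -
      have "4 * t - x\<^sup>2 = (2 * r)\<^sup>2 * (1 - u\<^sup>2)"
        using r by (simp add: u_def field_simps power2_eq_square)
      then show ?thesis using r by (simp add: real_sqrt_mult q_def)
    qed
    finally show "(?F has_vector_derivative complex_of_real (sqrt (4 * t - x\<^sup>2)) * K (x / (2 * r))) (at x)"
      unfolding u_def .
  qed
  moreover have "?F (2 * r) - ?F (- 2 * r) = complex_of_real (4 * t) * (\<Phi> (pi / 2) - \<Phi> (- pi / 2))"
    using r by (simp add: right_diff_distrib)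
  ultimately show ?thesis by (simp add: r_def)
qed

text \<open>With \<open>q = 1/v\<close>, \<open>A = i q e\<^sup>i\<^sup>\<theta>\<close> and \<open>B = - i q e\<^sup>-\<^sup>i\<^sup>\<theta>\<close> one has
  \<open>(1 + A) (1 + B) = q (v + q - 2 sin \<theta>)\<close>, so partial fractions turn the integrand into
  logarithmic derivatives of \<open>1 + A\<close> and \<open>1 + B\<close>.\<close>

lemma semicircle_primitive:
  fixes v :: complex and \<theta> :: real
  assumes v: "norm v > 1"
  defines "q \<equiv> 1 / v"
  defines "\<Psi> \<equiv> (\<lambda>x. (v + q) * x - 2 * cos x - (v - q) * (x + \<i> * Ln (1 + \<i> * q * exp (\<i> * x))
    - \<i> * Ln (1 - \<i> * q * exp (- \<i> * x))))"
  shows "((\<lambda>x. \<Psi> (complex_of_real x)) has_vector_derivative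
      complex_of_real ((cos \<theta>)\<^sup>2) * (4 / (v + q - 2 * complex_of_real (sin \<theta>)))) (at \<theta>)"
    and "v + q - 2 * complex_of_real (sin \<theta>) \<noteq> 0"
proof -
  have v0: "v \<noteq> 0" and vq: "v * q = 1" using v by (auto simp: q_def)
  have nq: "norm q < 1" using v by (auto simp: q_def norm_divide divide_less_eq_1)
  define T where "T = complex_of_real \<theta>"
  define A where "A = \<i> * q * exp (\<i> * T)"
  define B where "B = - \<i> * q * exp (- \<i> * T)"
  \<comment> \<open>This keeps \<open>1 + A\<close> and \<open>1 + B\<close> in the right
    half-plane, where the principal \<open>Ln\<close> is differentiable; no branch change occurs
    along the path.\<close>
  have nA: "norm A < 1" and nB: "norm B < 1"
    using nq by (auto simp: A_def B_def norm_mult T_def)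
  have ReA: "Re (1 + A) > 0" using abs_Re_le_cmod[of A] nA by simp
  have ReB: "Re (1 + B) > 0" using abs_Re_le_cmod[of B] nB by simp
  have nzA: "1 + A \<noteq> 0" and nzB: "1 + B \<noteq> 0" using ReA ReB by (metis less_irrefl zero_complex.sel(1))+
  have notA: "1 + A \<notin> \<real>\<^sub>\<le>\<^sub>0" and notB: "1 + B \<notin> \<real>\<^sub>\<le>\<^sub>0"
    using ReA ReB by (auto simp: complex_nonpos_Reals_iff)
  define S where "S = 2 * sin T"
  have E: "exp (\<i> * T) * exp (- \<i> * T) = 1" by (simp flip: exp_add)
  have AB: "A * B = q\<^sup>2"
  proof -
    have "A * B = - (\<i> * \<i>) * q\<^sup>2 * (exp (\<i> * T) * exp (- \<i> * T))"
      by (simp only: A_def B_def power2_eq_square mult_minus_left mult_minus_right mult_ac)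
    then show ?thesis by (simp only: E) simp
  qed
  have ApB: "A + B = - q * S"
    by (simp add: A_def B_def S_def sin_exp_eq field_simps)
  have prod: "(1 + A) * (1 + B) = q * (v + q - S)"
  proof -
    have "(1 + A) * (1 + B) = 1 + (A + B) + A * B" by (simp add: algebra_simps)
    then show ?thesis using vq unfolding AB ApB by (simp add: algebra_simps power2_eq_square)
  qed
  have nz: "v + q - S \<noteq> 0" using prod nzA nzB by auto
  have frac: "1 - A / (1 + A) - B / (1 + B) = (v - q) / (v + q - S)"
  proof -
    have "1 - A / (1 + A) - B / (1 + B) = (1 - A * B) / ((1 + A) * (1 + B))"
      using nzA nzB by (simp add: field_simps)
    also have "\<dots> = (q * (v - q)) / (q * (v + q - S))"
      unfolding prod AB using vq by (simp add: algebra_simps power2_eq_square)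
    also have "\<dots> = (v - q) / (v + q - S)" using v0 by (simp add: q_def)
    finally show ?thesis .
  qed
  have "(\<Psi> has_field_derivative (v + q) + S - (v - q) * (1 - A / (1 + A) - B / (1 + B))) (at T)"
    unfolding \<Psi>_def S_def using notA notB nzA nzB
    by (auto intro!: derivative_eq_intros simp: A_def B_def algebra_simps divide_inverse)
  \<comment> \<open>Polynomial division: for X = v + q, (X + S) (X - S) - (v - q)^2 = 4 - S^2 = 4
    cos^2 T, because v q = 1 gives (v - q)^2 = X^2 - 4.\<close>
  also have "(v + q) + S - (v - q) * (1 - A / (1 + A) - B / (1 + B)) = (cos T)\<^sup>2 * (4 / (v + q - S))"
  proof -
    have "S\<^sup>2 = 4 - 4 * (cos T)\<^sup>2" by (simp add: S_def power_mult_distrib sin_squared_eq)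
    moreover have "(v - q) * (v - q) = (v + q)\<^sup>2 - 4" using vq by (simp add: algebra_simps power2_eq_square)
    ultimately have "((v + q) + S) * (v + q - S) - (v - q) * (v - q) = 4 * (cos T)\<^sup>2"
      by (simp add: algebra_simps power2_eq_square)
    then show ?thesis unfolding frac using nz by (simp add: divide_simps)
  qed
  finally have "(\<Psi> has_field_derivative (cos T)\<^sup>2 * (4 / (v + q - S))) (at T)" .
  then show "((\<lambda>x. \<Psi> (complex_of_real x)) has_vector_derivative
      complex_of_real ((cos \<theta>)\<^sup>2) * (4 / (v + q - 2 * complex_of_real (sin \<theta>)))) (at \<theta>)"
    unfolding T_def S_def by (intro has_vector_derivative_real_field) (simp add: cos_of_real sin_of_real)
  show "v + q - 2 * complex_of_real (sin \<theta>) \<noteq> 0"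
    using nz by (simp add: S_def T_def sin_of_real)
qed

context
  fixes t :: real
  assumes t: "t > 0"
begin

lemma has_integral_semicircle_mass:
  "((\<lambda>x. complex_of_real (sqrt (4 * t - x\<^sup>2))) has_integral complex_of_real (2 * pi * t)) {- 2 * sqrt t .. 2 * sqrt t}"
proof -
  let ?\<Phi> = "\<lambda>\<theta>. (\<theta> + sin \<theta> * cos \<theta>) / 2 :: real"
  have rd: "(?\<Phi> has_real_derivative (cos \<theta>)\<^sup>2) (at \<theta>)" for \<theta>
    by (auto intro!: derivative_eq_intros simp: power2_eq_square[symmetric] sin_squared_eq field_simps)
  have "((\<lambda>\<theta>. complex_of_real (?\<Phi> \<theta>)) has_vector_derivative complex_of_real ((cos \<theta>)\<^sup>2) * 1) (at \<theta>)" for \<theta>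
    using has_vector_derivative_of_real[OF rd[of \<theta>], where 'a = complex] by simp
  from has_integral_sqrt_arcsin_substitution[OF t this] show ?thesis
    by (simp add: mult_ac)
qed

text \<open>Points off the support are written as u + t / u with |u| > sqrt t. Rescaling by sqrt t
  reduces the integral to \<open>semicircle_primitive\<close>.\<close>

lemma has_integral_semicircle_cauchy:
  assumes u: "norm u > sqrt t"
  shows "((\<lambda>x. complex_of_real (sqrt (4 * t - x\<^sup>2)) * (1 / (u + complex_of_real t / u - complex_of_real x)))
    has_integral complex_of_real (2 * pi * t) / u) {- 2 * sqrt t .. 2 * sqrt t}"
    and "x \<in> {- 2 * sqrt t .. 2 * sqrt t} \<Longrightarrow> u + complex_of_real t / u - complex_of_real x \<noteq> 0"
proof -
  define r where "r = sqrt t"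
  have r: "r > 0" "t = r\<^sup>2" "norm u > r" using t u by (auto simp: r_def)
  have u0: "u \<noteq> 0" using r by auto
  define v where "v = u / complex_of_real r"
  have v: "norm v > 1" using r by (simp add: v_def norm_divide)
  define q where "q = 1 / v"
  have uv: "u = complex_of_real r * v" using r by (simp add: v_def)
  have tq: "complex_of_real t / u = complex_of_real r * q"
    using r u0 by (simp add: q_def v_def field_simps power2_eq_square)
  have split: "u + complex_of_real t / u - complex_of_real (2 * r * y) = complex_of_real r * (v + q - 2 * complex_of_real y)" for y
    unfolding tq by (subst uv) (simp add: algebra_simps)
  define \<Psi> where "\<Psi> = (\<lambda>x. (v + q) * x - 2 * cos x - (v - q) * (x + \<i> * Ln (1 + \<i> * q * exp (\<i> * x))
    - \<i> * Ln (1 - \<i> * q * exp (- \<i> * x))))"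
  have der: "((\<lambda>x. \<Psi> (complex_of_real x)) has_vector_derivative
      complex_of_real ((cos \<theta>)\<^sup>2) * (4 / (v + q - 2 * complex_of_real (sin \<theta>)))) (at \<theta>)" for \<theta>
    unfolding \<Psi>_def q_def by (rule semicircle_primitive(1)[OF v])
  \<comment> \<open>At each end point the two logarithms have the same argument and cancel, and the
    cosine vanishes. What remains is (v + q) pi - (v - q) pi.\<close>
  have "\<Psi> (complex_of_real (pi / 2)) - \<Psi> (complex_of_real (- pi / 2)) = 2 * complex_of_real pi * q"
  proof -
    have e: "exp (\<i> * complex_of_real (pi / 2)) = \<i>" "exp (- \<i> * complex_of_real (pi / 2)) = - \<i>"
      "exp (\<i> * complex_of_real (- pi / 2)) = - \<i>" "exp (- \<i> * complex_of_real (- pi / 2)) = \<i>"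
      by (simp_all only: mult_minus_left exp_Euler exp_minus_Euler cos_of_real sin_of_real) simp_all
    have c: "cos (complex_of_real (pi / 2)) = 0" "cos (complex_of_real (- pi / 2)) = 0"
      by (simp_all only: cos_of_real) simp_all
    show ?thesis unfolding \<Psi>_def e c by (simp add: algebra_simps)
  qed
  note diff = this
  have "((\<lambda>x. complex_of_real (sqrt (4 * t - x\<^sup>2)) * (4 / (v + q - 2 * complex_of_real (x / (2 * sqrt t)))))
      has_integral complex_of_real (4 * t) * (2 * complex_of_real pi * q)) {- 2 * sqrt t .. 2 * sqrt t}"
    using has_integral_sqrt_arcsin_substitution[OF t der] unfolding diff .
  then have "((\<lambda>x. complex_of_real (sqrt (4 * t - x\<^sup>2)) * (4 / (v + q - 2 * complex_of_real (x / (2 * sqrt t)))) * (1 / (4 * complex_of_real r)))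
      has_integral complex_of_real (4 * t) * (2 * complex_of_real pi * q) * (1 / (4 * complex_of_real r))) {- 2 * sqrt t .. 2 * sqrt t}"
    by (rule has_integral_mult_left)
  moreover have "complex_of_real (4 * t) * (2 * complex_of_real pi * q) * (1 / (4 * complex_of_real r)) = complex_of_real (2 * pi * t) / u"
    using r u0 by (simp add: q_def v_def field_simps)
  moreover have "4 / (v + q - 2 * complex_of_real (x / (2 * sqrt t))) * (1 / (4 * complex_of_real r)) =
      1 / (u + complex_of_real t / u - complex_of_real x)" for x
  proof -
    have "2 * r * (x / (2 * sqrt t)) = x" using r(1) by (simp add: r_def)
    then show ?thesis using split[of "x / (2 * sqrt t)"] by simp
  qed
  ultimately show "((\<lambda>x. complex_of_real (sqrt (4 * t - x\<^sup>2)) * (1 / (u + complex_of_real t / u - complex_of_real x)))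
    has_integral complex_of_real (2 * pi * t) / u) {- 2 * sqrt t .. 2 * sqrt t}"
    by (simp only: mult.assoc)
  assume x: "x \<in> {- 2 * sqrt t .. 2 * sqrt t}"
  define \<theta> where "\<theta> = arcsin (x / (2 * r))"
  have "sin \<theta> = x / (2 * r)" unfolding \<theta>_def using x r by (intro sin_arcsin) (auto simp: r_def[symmetric] divide_simps)
  then have "x = 2 * r * sin \<theta>" using r by simp
  then show "u + complex_of_real t / u - complex_of_real x \<noteq> 0"
    using split[of "sin \<theta>"] semicircle_primitive(2)[OF v, of \<theta>] r by (simp add: q_def)
qed

text \<open>Transfers gauge integrals to the density; continuity on the compact support gives
  absolute integrability.\<close>

lemma integral_semicircular:
  fixes f :: "real \<Rightarrow> complex"
  assumes [measurable]: "f \<in> borel_measurable borel" and f: "continuous_on {- 2 * sqrt t .. 2 * sqrt t} f"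
    and I: "((\<lambda>x. complex_of_real (sqrt (4 * t - x\<^sup>2)) * f x) has_integral I) {- 2 * sqrt t .. 2 * sqrt t}"
  shows "integrable (semicircular t) f" "(\<integral>x. f x \<partial>semicircular t) = I / complex_of_real (2 * pi * t)"
proof -
  let ?S = "{- 2 * sqrt t .. 2 * sqrt t}"
  let ?d = "\<lambda>x. indicator ?S x * (sqrt (4 * t - x\<^sup>2) / (2 * pi * t))"
  have d0: "0 \<le> ?d x" for x
  proof (cases "x \<in> ?S")
    case True
    then have "\<bar>x\<bar> \<le> 2 * sqrt t" by auto
    then have "x\<^sup>2 \<le> (2 * sqrt t)\<^sup>2" by (rule power2_le_iff_abs_le[THEN iffD2, rotated]) (use t in auto)
    then show ?thesis using t by (simp add: power_mult_distrib)
  qed simp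
  have eq: "?d x *\<^sub>R f x = indicator ?S x *\<^sub>R (complex_of_real (sqrt (4 * t - x\<^sup>2)) * f x / complex_of_real (2 * pi * t))" for x
    by (simp add: scaleR_conv_of_real indicator_def)
  have int: "set_integrable lborel ?S (\<lambda>x. complex_of_real (sqrt (4 * t - x\<^sup>2)) * f x / complex_of_real (2 * pi * t))"
    using t by (intro borel_integrable_atLeastAtMost' continuous_intros f) auto
  then show "integrable (semicircular t) f"
    unfolding semicircular_def set_integrable_def using d0 eq
    by (subst integrable_density) auto
  have "(\<integral>x. f x \<partial>semicircular t) = (\<integral>x. ?d x *\<^sub>R f x \<partial>lborel)"
    unfolding semicircular_def using d0 by (intro integral_density) auto
  also have "\<dots> = (LINT x:?S|lborel. complex_of_real (sqrt (4 * t - x\<^sup>2)) * f x / complex_of_real (2 * pi * t))"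
    unfolding set_lebesgue_integral_def eq ..
  also have "\<dots> = I / complex_of_real (2 * pi * t)"
    by (rule trans[OF set_borel_integral_eq_integral(2)[OF int] integral_unique[OF has_integral_divide[OF I]]])
  finally show "(\<integral>x. f x \<partial>semicircular t) = I / complex_of_real (2 * pi * t)" .
qed

lemma real_distribution_semicircular: "real_distribution (semicircular t)"
proof -
  have 1: "integrable (semicircular t) (\<lambda>_. 1 :: complex)"
    "(\<integral>x. 1 \<partial>semicircular t) = complex_of_real (2 * pi * t) / complex_of_real (2 * pi * t)"
    using integral_semicircular[of "\<lambda>_. 1"] has_integral_semicircle_mass by auto
  have sp: "space (semicircular t) = UNIV" by (simp add: semicircular_def)
  have "emeasure (semicircular t) UNIV \<noteq> \<infinity>"
    using 1(1) sp by (auto simp: integrable_iff_bounded)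
  moreover have "complex_of_real (measure (semicircular t) UNIV) = 1"
    using 1(2) t sp by (simp add: scaleR_conv_of_real)
  ultimately have "emeasure (semicircular t) (space (semicircular t)) = 1"
    by (simp add: sp emeasure_eq_ennreal_measure)
  then interpret prob_space "semicircular t" by (rule prob_spaceI)
  show ?thesis by unfold_locales (simp add: semicircular_def)
qed

text \<open>In the variable u the right inverse u + t / u of F is visible at once, without choosing
  a branch of sqrt (z^2 - 4 t).\<close>

lemma cauchy_transform_semicircular:
  assumes "norm u > sqrt t"
  shows "cauchy_transform (semicircular t) (u + complex_of_real t / u) = 1 / u"
proof -
  have "cauchy_transform (semicircular t) (u + complex_of_real t / u) =
      (complex_of_real (2 * pi * t) / u) / complex_of_real (2 * pi * t)"
    unfolding cauchy_transform_def using has_integral_semicircle_cauchy[OF assms]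
    by (intro integral_semicircular(2) continuous_intros) auto
  then show ?thesis using t by simp
qed

lemma Im_semicircular_right_inverse_pos:
  assumes "Im z > 0" "norm z > sqrt t"
  shows "Im (z + complex_of_real t / z) > 0"
proof -
  have "(norm z)\<^sup>2 > (sqrt t)\<^sup>2" using assms t by (intro power_strict_mono) auto
  then have lt: "t < (norm z)\<^sup>2" using t by simp
  then have "Im z * (1 - t / (norm z)\<^sup>2) > 0" using assms t by (intro mult_pos_pos) (auto simp: divide_simps)
  moreover have "Im (z + complex_of_real t / z) = Im z * (1 - t / (norm z)\<^sup>2)"
    by (simp add: Im_divide cmod_power2 algebra_simps)
  ultimately show ?thesis by simp
qed

lemma is_right_inverse_on_semicircular:
  assumes b: "sqrt t \<le> \<beta>"
  shows "is_right_inverse_on (semicircular t) \<alpha> \<beta> (\<lambda>z. z + complex_of_real t / z)"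
proof -
  \<comment> \<open>Height above sqrt t puts z outside the critical circle |z| = sqrt t of z + t /
    z.\<close>
  have cone: "Im z > 0" "norm z > sqrt t" "z \<noteq> 0" if "z \<in> truncated_cone \<alpha> \<beta>" for z
    using that b abs_Im_le_cmod[of z] by (auto simp: truncated_cone_def)
  show ?thesis
    unfolding is_right_inverse_on_def
  proof (intro conjI ballI)
    show "(\<lambda>z. z + complex_of_real t / z) analytic_on truncated_cone \<alpha> \<beta>"
      using cone by (intro analytic_intros) auto
    show "(\<lambda>z. z + complex_of_real t / z) ` truncated_cone \<alpha> \<beta> \<subseteq> upper_half_plane"
      using Im_semicircular_right_inverse_pos cone by auto
    show "reciprocal_cauchy (semicircular t) (z + complex_of_real t / z) = z" if "z \<in> truncated_cone \<alpha> \<beta>" for z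
      using cauchy_transform_semicircular[of z] cone[OF that] by (simp add: reciprocal_cauchy_def)
    let ?F = "inf at_infinity (principal (truncated_cone \<alpha> \<beta>))"
    have "((\<lambda>z. 1 + complex_of_real t / (z * z)) \<longlongrightarrow> 1 + 0) at_infinity"
    proof -
      have "((\<lambda>z::complex. k / z) \<longlongrightarrow> 0) at_infinity" for k
        by (intro tendsto_divide_0[OF tendsto_const] filterlim_ident)
      from tendsto_add[OF tendsto_const tendsto_mult[OF this[of "complex_of_real t"] this[of 1]], of 1]
      show ?thesis by simp
    qed
    then have "((\<lambda>z. 1 + complex_of_real t / (z * z)) \<longlongrightarrow> 1) ?F" by (simp add: tendsto_mono[OF inf_le1])
    then show "((\<lambda>z. (z + complex_of_real t / z) / z) \<longlongrightarrow> 1) ?F"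
      by (rule Lim_transform_eventually) (use cone in \<open>auto simp: eventually_inf_principal add_divide_distrib\<close>)
  qed
qed

end

section \<open>Representation of analytic functions as Cauchy transforms\<close>

lemma norm_sq_diff_of_real: "complex_of_real ((norm (z - complex_of_real s))\<^sup>2) = (complex_of_real s - z) * (complex_of_real s - cnj z)"
  unfolding cmod_power2 by (simp add: complex_eq_iff power2_eq_square algebra_simps)

lemma has_integral_poisson_kernel:
  assumes z: "Im z > 0" and R: "R \<ge> 0"
  shows "((\<lambda>s. Im z / (norm (z - complex_of_real s))\<^sup>2) has_integral
    arctan ((R - Re z) / Im z) - arctan ((- R - Re z) / Im z)) {- R .. R}"
proof (rule fundamental_theorem_of_calculus)
  show "- R \<le> R" using R by simp
  fix s assume "s \<in> {- R .. R}"
  have nrm: "(norm (z - complex_of_real s))\<^sup>2 = (s - Re z)\<^sup>2 + (Im z)\<^sup>2"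
    by (simp add: cmod_power2 power2_commute)
  have "1 + ((s - Re z) / Im z)\<^sup>2 = ((s - Re z)\<^sup>2 + (Im z)\<^sup>2) / (Im z)\<^sup>2"
    using z by (simp add: power_divide add_divide_distrib)
  then have "inverse (1 + ((s - Re z) / Im z)\<^sup>2) / Im z = Im z / (norm (z - complex_of_real s))\<^sup>2"
    unfolding nrm using z by (simp add: power2_eq_square)
  then have "((\<lambda>s. arctan ((s - Re z) / Im z)) has_real_derivative Im z / (norm (z - complex_of_real s))\<^sup>2) (at s within {- R .. R})"
    using z by (auto intro!: derivative_eq_intros)
  then show "((\<lambda>s. arctan ((s - Re z) / Im z)) has_vector_derivative Im z / (norm (z - complex_of_real s))\<^sup>2) (at s within {- R .. R})"
    by (simp add: has_real_derivative_iff_has_vector_derivative)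
qed

lemma arctan_poisson_tendsto:
  assumes z: "Im z > 0"
  shows "((\<lambda>R. arctan ((R - Re z) / Im z) - arctan ((- R - Re z) / Im z)) \<longlongrightarrow> pi) at_top"
proof -
  have 1: "filterlim (\<lambda>R. (1 / Im z) * (c + R)) at_top at_top" for c
    using z by (intro filterlim_tendsto_pos_mult_at_top[OF tendsto_const]
        filterlim_tendsto_add_at_top[OF tendsto_const] filterlim_ident) auto
  have "filterlim (\<lambda>R. (R - Re z) / Im z) at_top at_top" using 1[of "- Re z"] by simp
  then have a: "((\<lambda>R. arctan ((R - Re z) / Im z)) \<longlongrightarrow> pi / 2) at_top"
    by (rule filterlim_compose[OF tendsto_arctan_at_top])
  have "filterlim (\<lambda>R. - ((1 / Im z) * (Re z + R))) at_bot at_top"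
    using 1[of "Re z"] by (simp add: filterlim_uminus_at_bot)
  then have "filterlim (\<lambda>R. (- R - Re z) / Im z) at_bot at_top"
    by (simp add: minus_divide_left[symmetric] diff_divide_distrib add_divide_distrib add.commute)
  then have b: "((\<lambda>R. arctan ((- R - Re z) / Im z)) \<longlongrightarrow> - (pi / 2)) at_top"
    by (rule filterlim_compose[OF tendsto_arctan_at_bot])
  from tendsto_diff[OF a b] show ?thesis by simp
qed

text \<open>The difference quotient \<open>(f w - f z) / ((w - z) (w - cnj z))\<close> has a primitive on a half-plane and is
  \<open>O(1 / |w|\<^sup>2)\<close>, so its integral over \<open>[-R, R]\<close> can be bounded along three sides of a rectangle.\<close>

lemma poisson_difference_tendsto:
  fixes f :: "complex \<Rightarrow> complex"
  assumes e: "\<epsilon> > 0" and f: "f holomorphic_on {w. Im w > - \<epsilon>}"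
    and bound: "\<And>w. Im w \<ge> 0 \<Longrightarrow> norm (f w) \<le> C" and z: "Im z > 0"
  obtains I where
    "\<And>R. R \<ge> 0 \<Longrightarrow> ((\<lambda>s. (f (complex_of_real s) - f z) / complex_of_real ((norm (z - complex_of_real s))\<^sup>2)) has_integral I R) {- R .. R}"
    "(I \<longlongrightarrow> 0) at_top"
proof -
  \<comment> \<open>Besides staying in the domain of f, \<open>U\<close> must avoid the conjugate of
    z, where the second factor of the denominator vanishes.\<close>
  define \<delta> where "\<delta> = min \<epsilon> (Im z)"
  define U where "U = {w. Im w > - \<delta>}"
  have U: "open U" "convex U" "z \<in> U"
    unfolding U_def using e z by (auto intro: open_halfspace_Im_gt convex_halfspace_Im_gt simp: \<delta>_def)
  have UU: "U \<subseteq> {w. Im w > - \<epsilon>}" by (auto simp: U_def \<delta>_def)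
  \<comment> \<open>The difference quotient with its singularity at z removed, so that a primitive
    exists on all of \<open>U\<close>.\<close>
  define k where "k = (\<lambda>w. if w = z then deriv f z else (f w - f z) / (w - z))"
  have holk: "k holomorphic_on U"
    unfolding k_def by (rule pole_lemma_open[OF holomorphic_on_subset[OF f UU] U(1)])
  have holh: "(\<lambda>w. k w / (w - cnj z)) holomorphic_on U"
    by (intro holomorphic_intros holk) (auto simp: U_def \<delta>_def)
  obtain P where P: "\<And>w. w \<in> U \<Longrightarrow> (P has_field_derivative k w / (w - cnj z)) (at w within U)"
    by (rule holomorphic_convex_primitive'[OF U(2,1) holh]) (rule that)
  have P': "(P has_field_derivative k w / (w - cnj z)) (at w)" if "w \<in> U" for w
    using P[OF that] at_within_open[OF that U(1)] by simp
  have realU: "complex_of_real s \<in> U" for s using e z by (auto simp: U_def \<delta>_def)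
  have C0: "C \<ge> 0" using bound[of 0] by (auto intro: order_trans[OF norm_ge_zero])
  have bd: "norm (k w / (w - cnj z)) \<le> 2 * C / (R - norm z)\<^sup>2"
    if w: "Im w \<ge> 0" "norm w \<ge> R" and R: "R > norm z" for w R
  proof -
    have d: "norm (w - z) \<ge> R - norm z" "norm (w - cnj z) \<ge> R - norm z"
      using norm_triangle_ineq2[of w z] norm_triangle_ineq2[of w "cnj z"] w by auto
    have "w \<noteq> z" using w R by auto
    then have "norm (k w / (w - cnj z)) = norm (f w - f z) / (norm (w - z) * norm (w - cnj z))"
      by (simp add: k_def norm_divide norm_mult)
    also have "\<dots> \<le> (C + C) / ((R - norm z) * (R - norm z))"
      using d R C0 bound[OF w(1)] bound[of z] z norm_triangle_ineq4[of "f w" "f z"]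
      by (intro frac_le mult_mono mult_pos_pos) auto
    finally show ?thesis by (simp add: power2_eq_square)
  qed
  have seg: "norm (P a - P b) \<le> 2 * C / (R - norm z)\<^sup>2 * norm (a - b)"
    if R: "R > norm z" and ab: "\<And>w. w \<in> closed_segment a b \<Longrightarrow> Im w \<ge> 0 \<and> norm w \<ge> R" for a b R
  proof (rule field_differentiable_bound[of "closed_segment a b" P "\<lambda>w. k w / (w - cnj z)"])
    fix w assume w: "w \<in> closed_segment a b"
    then have "w \<in> U" using ab[OF w] e z by (auto simp: U_def \<delta>_def)
    then show "(P has_field_derivative k w / (w - cnj z)) (at w within closed_segment a b)"
      using P' has_field_derivative_at_within by blast
    show "norm (k w / (w - cnj z)) \<le> 2 * C / (R - norm z)\<^sup>2"
      using ab[OF w] R by (intro bd) auto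
  qed auto
  define I where "I R = P (complex_of_real R) - P (complex_of_real (- R))" for R
  have 1: "((\<lambda>s. (f (complex_of_real s) - f z) / complex_of_real ((norm (z - complex_of_real s))\<^sup>2)) has_integral I R) {- R .. R}"
    if "R \<ge> 0" for R
    unfolding I_def
  proof (rule fundamental_theorem_of_calculus)
    fix s assume "s \<in> {- R .. R}"
    have "complex_of_real s \<noteq> z" using z by auto
    then have "k (complex_of_real s) / (complex_of_real s - cnj z) =
        (f (complex_of_real s) - f z) / complex_of_real ((norm (z - complex_of_real s))\<^sup>2)"
      unfolding norm_sq_diff_of_real by (simp add: k_def)
    then show "((\<lambda>s. P (complex_of_real s)) has_vector_derivative
        (f (complex_of_real s) - f z) / complex_of_real ((norm (z - complex_of_real s))\<^sup>2)) (at s within {- R .. R})"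
      using P'[OF realU[of s]] by (metis has_vector_derivative_at_within has_vector_derivative_real_field)
  qed (use that in auto)
  have 2: "(I \<longlongrightarrow> 0) at_top"
  proof (rule Lim_null_comparison)
    show "\<forall>\<^sub>F R in at_top. norm (I R) \<le> 8 * C * R / (R - norm z)\<^sup>2"
      using eventually_gt_at_top[of "norm z"]
    proof eventually_elim
      fix R assume R: "R > norm z"
      then have R0: "R > 0" using norm_ge_zero[of z] by linarith
      \<comment> \<open>The path from R to -R runs along three sides of length R, 2 R and R, all at
        distance at least R from 0.\<close>
      define a b c d where "a = Complex R 0" and "b = Complex R R" and "c = Complex (- R) R" and "d = Complex (- R) 0"
      let ?K = "2 * C / (R - norm z)\<^sup>2"
      have big: "norm w \<ge> R" if "\<bar>Re w\<bar> = R \<or> Im w = R" for w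
        using that abs_Re_le_cmod[of w] abs_Im_le_cmod[of w] by auto
      have "norm (P a - P b) \<le> ?K * norm (a - b)"
      proof (rule seg[OF R])
        fix w assume "w \<in> closed_segment a b"
        then obtain u where "0 \<le> u" "u \<le> 1" and w: "w = (1 - u) *\<^sub>R a + u *\<^sub>R b" by (auto simp: closed_segment_def)
        have "Re w = R" "Im w = u * R" 
          unfolding w a_def b_def by (simp_all add: algebra_simps)
        then show "Im w \<ge> 0 \<and> norm w \<ge> R" using big[of w] R0 \<open>0 \<le> u\<close> by auto
      qed
      moreover have "norm (P b - P c) \<le> ?K * norm (b - c)"
      proof (rule seg[OF R])
        fix w assume "w \<in> closed_segment b c"
        then obtain u where "0 \<le> u" "u \<le> 1" and w: "w = (1 - u) *\<^sub>R b + u *\<^sub>R c" by (auto simp: closed_segment_def)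
        have "Im w = R" 
          unfolding w b_def c_def by (simp_all add: algebra_simps)
        then show "Im w \<ge> 0 \<and> norm w \<ge> R" using big[of w] R0 by auto
      qed
      moreover have "norm (P c - P d) \<le> ?K * norm (c - d)"
      proof (rule seg[OF R])
        fix w assume "w \<in> closed_segment c d"
        then obtain u where "0 \<le> u" "u \<le> 1" and w: "w = (1 - u) *\<^sub>R c + u *\<^sub>R d" by (auto simp: closed_segment_def)
        have "Re w = - R" "Im w = (1 - u) * R" 
          unfolding w c_def d_def by (simp_all add: algebra_simps)
        then show "Im w \<ge> 0 \<and> norm w \<ge> R" using big[of w] R0 \<open>u \<le> 1\<close> by auto
      qed
      moreover have "norm (a - b) = R" "norm (b - c) = 2 * R" "norm (c - d) = R"
        using R0 by (auto simp: a_def b_def c_def d_def cmod_def real_sqrt_mult)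
      moreover have "I R = (P a - P b) + (P b - P c) + (P c - P d)"
        by (simp add: I_def a_def d_def complex_of_real_def)
      ultimately have "norm (I R) \<le> ?K * R + ?K * (2 * R) + ?K * R"
        by (metis (no_types, lifting) add_mono norm_triangle_le)
      then show "norm (I R) \<le> 8 * C * R / (R - norm z)\<^sup>2" by (simp add: field_simps)
    qed
    have l1: "filterlim (\<lambda>R. - norm z + R) at_top at_top"
      by (intro filterlim_tendsto_add_at_top[OF tendsto_const] filterlim_ident)
    have 0: "((\<lambda>R. 1 / (- norm z + R)) \<longlongrightarrow> 0) at_top"
      by (intro tendsto_divide_0[OF tendsto_const] filterlim_at_top_imp_at_infinity l1)
    have "((\<lambda>R. 8 * C * (1 / (- norm z + R) + norm z * (1 / (- norm z + R)) * (1 / (- norm z + R)))) \<longlongrightarrow>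
        8 * C * (0 + norm z * 0 * 0)) at_top"
      by (intro tendsto_intros 0)
    then have "((\<lambda>R. 8 * C * (1 / (- norm z + R) + norm z * (1 / (- norm z + R)) * (1 / (- norm z + R)))) \<longlongrightarrow> 0) at_top"
      by simp
    then show "((\<lambda>R. 8 * C * R / (R - norm z)\<^sup>2) \<longlongrightarrow> 0) at_top"
    proof (rule Lim_transform_eventually)
      show "\<forall>\<^sub>F R in at_top. 8 * C * (1 / (- norm z + R) + norm z * (1 / (- norm z + R)) * (1 / (- norm z + R))) =
          8 * C * R / (R - norm z)\<^sup>2"
        using eventually_gt_at_top[of "norm z"]
      proof eventually_elim
        fix R assume R: "R > norm z"
        define D where "D = R - norm z"
        have D: "D > 0" "R = D + norm z" using R by (auto simp: D_def)
        show "8 * C * (1 / (- norm z + R) + norm z * (1 / (- norm z + R)) * (1 / (- norm z + R))) = 8 * C * R / (R - norm z)\<^sup>2"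
          unfolding D(2) using D(1) by (simp add: field_simps power2_eq_square)
      qed
    qed
  qed
  show thesis by (rule that[OF 1 2])
qed

text \<open>Split f(s) = f(z) + (f(s) - f(z)): the first part contributes Im f(z) times the mass of
  the Poisson kernel, which tends to pi, and the second tends to 0 by
  \<open>poisson_difference_tendsto\<close>.\<close>

lemma poisson_integral_tendsto:
  fixes f :: "complex \<Rightarrow> complex"
  assumes e: "\<epsilon> > 0" and f: "f holomorphic_on {w. Im w > - \<epsilon>}"
    and bound: "\<And>w. Im w \<ge> 0 \<Longrightarrow> norm (f w) \<le> C" and z: "Im z > 0"
  obtains J where
    "\<And>R. R \<ge> 0 \<Longrightarrow> ((\<lambda>s. Im (f (complex_of_real s)) * (Im z / (norm (z - complex_of_real s))\<^sup>2)) has_integral J R) {- R .. R}"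
    "(J \<longlongrightarrow> pi * Im (f z)) at_top"
proof -
  obtain I where I: "\<And>R. R \<ge> 0 \<Longrightarrow> ((\<lambda>s. (f (complex_of_real s) - f z) / complex_of_real ((norm (z - complex_of_real s))\<^sup>2)) has_integral I R) {- R .. R}"
    "(I \<longlongrightarrow> 0) at_top"
    by (rule poisson_difference_tendsto[OF e f _ z]) (rule bound, assumption, rule that)
  define A where "A R = arctan ((R - Re z) / Im z) - arctan ((- R - Re z) / Im z)" for R
  define J where "J R = Im (f z) * A R + Im z * Im (I R)" for R
  have 1: "((\<lambda>s. Im (f (complex_of_real s)) * (Im z / (norm (z - complex_of_real s))\<^sup>2)) has_integral J R) {- R .. R}"
    if R: "R \<ge> 0" for R
  proof -
    have "((\<lambda>s. Im ((f (complex_of_real s) - f z) / complex_of_real ((norm (z - complex_of_real s))\<^sup>2))) has_integral Im (I R)) {- R .. R}"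
      using has_integral_Im[OF I(1)[OF R]] .
    then have "((\<lambda>s. Im (f z) * (Im z / (norm (z - complex_of_real s))\<^sup>2) +
       Im z * Im ((f (complex_of_real s) - f z) / complex_of_real ((norm (z - complex_of_real s))\<^sup>2))) has_integral J R) {- R .. R}"
      unfolding J_def A_def
      by (intro has_integral_add has_integral_mult_right has_integral_poisson_kernel[OF z R])
    moreover have "Im (f z) * (Im z / (norm (z - complex_of_real s))\<^sup>2) +
       Im z * Im ((f (complex_of_real s) - f z) / complex_of_real ((norm (z - complex_of_real s))\<^sup>2)) =
       Im (f (complex_of_real s)) * (Im z / (norm (z - complex_of_real s))\<^sup>2)" for s
      unfolding Im_divide_of_real by (simp add: diff_divide_distrib right_diff_distrib mult.commute)
    ultimately show ?thesis by simp
  qed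
  have 2: "(J \<longlongrightarrow> pi * Im (f z)) at_top"
  proof -
    have "(J \<longlongrightarrow> Im (f z) * pi + Im z * Im 0) at_top"
      unfolding J_def[abs_def] A_def by (intro tendsto_intros arctan_poisson_tendsto[OF z] I(2))
    then show ?thesis by (simp add: mult.commute)
  qed
  show thesis by (rule that[OF 1 2])
qed

text \<open>For a nonnegative function monotone convergence upgrades the limit over symmetric
  intervals to a Lebesgue integral.\<close>

lemma nn_integral_of_symmetric_limit:
  fixes g :: "real \<Rightarrow> real"
  assumes [measurable]: "g \<in> borel_measurable borel" and nn: "\<And>s. 0 \<le> g s"
    and J: "\<And>R. R \<ge> 0 \<Longrightarrow> (g has_integral J R) {- R .. R}" "(J \<longlongrightarrow> L) at_top"
  shows "(\<integral>\<^sup>+s. ennreal (g s) \<partial>lborel) = ennreal L"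
proof -
  let ?f = "\<lambda>n::nat. \<lambda>s. ennreal (indicator {- real n .. real n} s * g s)"
  have lim: "(\<lambda>n. \<integral>\<^sup>+s. ?f n s \<partial>lborel) \<longlonglongrightarrow> (\<integral>\<^sup>+s. ennreal (g s) \<partial>lborel)"
  proof (rule nn_integral_LIMSEQ)
    show "incseq ?f"
      using nn by (auto simp: incseq_def le_fun_def indicator_def intro!: ennreal_leI)
    fix s
    show "(\<lambda>n. ?f n s) \<longlonglongrightarrow> ennreal (g s)"
    proof (rule tendsto_eventually)
      obtain N :: nat where "\<bar>s\<bar> \<le> real N" using real_arch_simple by blast
      then show "\<forall>\<^sub>F n in sequentially. ?f n s = ennreal (g s)"
        by (intro eventually_sequentiallyI[of N]) (auto simp: indicator_def abs_le_iff)
    qed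
  qed auto
  have eq: "(\<integral>\<^sup>+s. ?f n s \<partial>lborel) = ennreal (J (real n))" for n
    using nn by (intro nn_integral_has_integral_lebesgue J(1)) auto
  have "(\<lambda>n. ennreal (J (real n))) \<longlonglongrightarrow> ennreal L"
    by (intro tendsto_ennrealI filterlim_compose[OF J(2)] filterlim_real_sequentially)
  then show ?thesis by (rule LIMSEQ_unique[OF lim[unfolded eq]])
qed

text \<open>The Cauchy transform of the density \<open>s \<mapsto> - Im G (s + i \<epsilon>) / pi\<close> is \<open>z \<mapsto> G (z + i \<epsilon>)\<close>;
  only the imaginary parts are needed.\<close>

lemma exists_distribution_shifted:
  fixes G :: "complex \<Rightarrow> complex"
  assumes hol: "G holomorphic_on upper_half_plane"
    and neg: "\<And>z. Im z > 0 \<Longrightarrow> Im (G z) \<le> 0"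
    and bound: "\<And>z. Im z > 0 \<Longrightarrow> norm (G z) \<le> 1 / Im z"
    and lim: "((\<lambda>y. Complex 0 y * G (Complex 0 y)) \<longlongrightarrow> 1) at_top"
    and e: "\<epsilon> > 0"
  shows "\<exists>M. real_distribution M \<and> (\<forall>z. Im z > 0 \<longrightarrow> Im (cauchy_transform M z) = Im (G (z + \<i> * complex_of_real \<epsilon>)))"
proof -
  define f where "f w = G (w + \<i> * complex_of_real \<epsilon>)" for w
  have f_hol: "f holomorphic_on {w. Im w > - \<epsilon>}"
  proof -
    have "(G \<circ> (\<lambda>w. w + \<i> * complex_of_real \<epsilon>)) holomorphic_on {w. Im w > - \<epsilon>}"
      by (intro holomorphic_on_compose_gen[OF _ hol] holomorphic_intros) auto
    then show ?thesis by (simp add: f_def[abs_def] o_def)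
  qed
  have f_bound: "norm (f w) \<le> 1 / \<epsilon>" if "Im w \<ge> 0" for w
  proof -
    have "norm (f w) \<le> 1 / (Im w + \<epsilon>)" unfolding f_def using bound[of "w + \<i> * complex_of_real \<epsilon>"] that e by simp
    also have "\<dots> \<le> 1 / \<epsilon>" using that e by (intro divide_left_mono) auto
    finally show ?thesis .
  qed
  define p where "p s = - Im (f (complex_of_real s)) / pi" for s :: real
  have p0: "p s \<ge> 0" for s
    unfolding p_def f_def using neg[of "complex_of_real s + \<i> * complex_of_real \<epsilon>"] e by (simp add: divide_nonpos_pos)
  have "continuous_on UNIV (\<lambda>s. f (complex_of_real s))"
    by (rule continuous_on_compose2[OF holomorphic_on_imp_continuous_on[OF f_hol]])
      (use e in \<open>auto intro!: continuous_intros\<close>)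
  then have "continuous_on UNIV p" unfolding p_def by (intro continuous_intros) auto
  then have [measurable]: "p \<in> borel_measurable borel" by (rule borel_measurable_continuous_onI)
  have poisson: "(\<integral>\<^sup>+s. ennreal (p s * (Im z / (norm (z - complex_of_real s))\<^sup>2)) \<partial>lborel) = ennreal (- Im (f z))"
    if z: "Im z > 0" for z
  proof -
    obtain J where J: "\<And>R. R \<ge> 0 \<Longrightarrow> ((\<lambda>s. Im (f (complex_of_real s)) * (Im z / (norm (z - complex_of_real s))\<^sup>2)) has_integral J R) {- R .. R}"
      "(J \<longlongrightarrow> pi * Im (f z)) at_top"
      by (rule poisson_integral_tendsto[OF e f_hol _ z]) (rule f_bound, assumption, rule that)
    have "((\<lambda>s. p s * (Im z / (norm (z - complex_of_real s))\<^sup>2)) has_integral (- 1 / pi) * J R) {- R .. R}" if "R \<ge> 0" for R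
      using has_integral_mult_right[OF J(1)[OF that], of "- 1 / pi"] by (simp add: p_def mult_ac)
    moreover have "((\<lambda>R. (- 1 / pi) * J R) \<longlongrightarrow> - Im (f z)) at_top"
      using tendsto_mult[OF tendsto_const J(2), of "- 1 / pi"] by simp
    ultimately show ?thesis using p0 z by (intro nn_integral_of_symmetric_limit) auto
  qed
  define M where "M = density lborel (\<lambda>s. ennreal (p s))"
  have sp: "space M = UNIV" "sets M = sets borel" by (auto simp: M_def)
  have mass: "(\<integral>\<^sup>+s. ennreal (p s) \<partial>lborel) = 1"
  proof -
    \<comment> \<open>The Poisson formula at i y, multiplied by y, weights p by y^2 / (y^2 + s^2).
      These weights increase to 1 with y, so the total mass is the limit of - y Im f(i y).\<close>
    let ?g = "\<lambda>n::nat. \<lambda>s. p s * ((real (Suc n))\<^sup>2 / ((real (Suc n))\<^sup>2 + s\<^sup>2))"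
    have "(\<lambda>n. \<integral>\<^sup>+s. ennreal (?g n s) \<partial>lborel) \<longlonglongrightarrow> (\<integral>\<^sup>+s. ennreal (p s) \<partial>lborel)"
    proof (rule nn_integral_LIMSEQ)
      show "incseq (\<lambda>n s. ennreal (?g n s))"
        unfolding incseq_def le_fun_def
      proof (intro allI impI ennreal_leI mult_left_mono p0)
        fix m n :: nat and s :: real assume "m \<le> n"
        then have "(real (Suc m))\<^sup>2 \<le> (real (Suc n))\<^sup>2" by (intro power_mono) auto
        moreover have "a / (a + s\<^sup>2) \<le> b / (b + s\<^sup>2)" if "a \<le> b" "a > 0" for a b
        proof -
          have "a * s\<^sup>2 \<le> b * s\<^sup>2" using that by (intro mult_right_mono) auto
          then show ?thesis using that by (auto simp: divide_simps algebra_simps add_pos_nonneg add_eq_0_iff)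
        qed
        ultimately show "(real (Suc m))\<^sup>2 / ((real (Suc m))\<^sup>2 + s\<^sup>2) \<le> (real (Suc n))\<^sup>2 / ((real (Suc n))\<^sup>2 + s\<^sup>2)"
          by (simp del: of_nat_Suc)
      qed
      fix s
      have lim: "filterlim (\<lambda>n. real (Suc n)) at_top sequentially"
        by (intro filterlim_compose[OF filterlim_real_sequentially] filterlim_Suc)
      have "(\<lambda>n. s / real (Suc n)) \<longlonglongrightarrow> 0"
        by (intro tendsto_divide_0[OF tendsto_const] filterlim_at_top_imp_at_infinity lim)
      then have "(\<lambda>n. p s * (1 / (1 + (s / real (Suc n))\<^sup>2))) \<longlonglongrightarrow> p s * (1 / (1 + 0\<^sup>2))"
        by (intro tendsto_intros) auto
      moreover have "1 / (1 + (s / real (Suc n))\<^sup>2) = (real (Suc n))\<^sup>2 / ((real (Suc n))\<^sup>2 + s\<^sup>2)" for n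
        by (simp add: power_divide add_divide_distrib[symmetric] divide_simps del: of_nat_Suc)
      ultimately show "(\<lambda>n. ennreal (?g n s)) \<longlonglongrightarrow> ennreal (p s)"
        by (intro tendsto_ennrealI) (simp del: of_nat_Suc)
    qed auto
    moreover have "(\<integral>\<^sup>+s. ennreal (?g n s) \<partial>lborel) = ennreal (real (Suc n) * - Im (f (Complex 0 (real (Suc n)))))" for n
    proof -
      have "(\<integral>\<^sup>+s. ennreal (?g n s) \<partial>lborel) = (\<integral>\<^sup>+s. ennreal (real (Suc n)) * ennreal (p s * (Im (Complex 0 (real (Suc n))) / (norm (Complex 0 (real (Suc n)) - complex_of_real s))\<^sup>2)) \<partial>lborel)"
        unfolding cmod_power2 using p0 by (intro nn_integral_cong) (simp add: power2_eq_square ennreal_mult'[symmetric] add.commute del: of_nat_Suc)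
      also have "\<dots> = ennreal (real (Suc n)) * ennreal (- Im (f (Complex 0 (real (Suc n)))))"
        by (subst nn_integral_cmult, simp, subst poisson) simp_all
      finally show ?thesis by (subst ennreal_mult') simp_all
    qed
    moreover have "(\<lambda>n. ennreal (real (Suc n) * - Im (f (Complex 0 (real (Suc n)))))) \<longlonglongrightarrow> ennreal 1"
    proof (intro tendsto_ennrealI)
      have lim': "filterlim (\<lambda>n. \<epsilon> + real (Suc n)) at_top sequentially"
        by (intro filterlim_tendsto_add_at_top[OF tendsto_const] filterlim_compose[OF filterlim_real_sequentially] filterlim_Suc)
      have a: "(\<lambda>n. Re (Complex 0 (\<epsilon> + real (Suc n)) * G (Complex 0 (\<epsilon> + real (Suc n))))) \<longlonglongrightarrow> Re 1"
        by (intro tendsto_Re filterlim_compose[OF lim lim'])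
      have "(\<lambda>n. 1 - \<epsilon> / (\<epsilon> + real (Suc n))) \<longlonglongrightarrow> 1 - 0"
        by (intro tendsto_diff tendsto_const tendsto_divide_0[OF tendsto_const] filterlim_at_top_imp_at_infinity lim')
      from tendsto_mult[OF a this]
      have "(\<lambda>n. Re (Complex 0 (\<epsilon> + real (Suc n)) * G (Complex 0 (\<epsilon> + real (Suc n)))) * (1 - \<epsilon> / (\<epsilon> + real (Suc n)))) \<longlonglongrightarrow> 1"
        by simp
      \<comment> \<open>f at height y is G at height \<epsilon> + y; the factor 1 - \<epsilon> /
        (\<epsilon> + y) turns the prefactor \<epsilon> + y back into y.\<close>
      moreover have "Re (Complex 0 (\<epsilon> + real (Suc n)) * G (Complex 0 (\<epsilon> + real (Suc n)))) * (1 - \<epsilon> / (\<epsilon> + real (Suc n))) =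
          real (Suc n) * - Im (f (Complex 0 (real (Suc n))))" for n
      proof -
        have "Complex 0 (real (Suc n)) + \<i> * complex_of_real \<epsilon> = Complex 0 (\<epsilon> + real (Suc n))"
          by (simp add: complex_eq_iff)
        moreover have "(\<epsilon> + real (Suc n)) * (1 - \<epsilon> / (\<epsilon> + real (Suc n))) = real (Suc n)"
          using e by (simp add: field_simps)
        ultimately show ?thesis by (simp add: f_def mult.commute mult.left_commute del: of_nat_Suc)
      qed
      ultimately show "(\<lambda>n. real (Suc n) * - Im (f (Complex 0 (real (Suc n))))) \<longlonglongrightarrow> 1"
        by (simp only:)
    qed
    ultimately have "(\<integral>\<^sup>+s. ennreal (p s) \<partial>lborel) = ennreal 1"
      by (simp only:) (rule LIMSEQ_unique)
    then show ?thesis by simp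
  qed
  have "emeasure M (space M) = 1"
    unfolding sp using mass by (simp add: M_def emeasure_density)
  then interpret prob_space M by (rule prob_spaceI)
  have M: "real_distribution M" by unfold_locales (simp add: sp)
  interpret M: real_distribution M by (rule M)
  have "Im (cauchy_transform M z) = Im (f z)" if z: "Im z > 0" for z
  proof -
    have "(\<integral>s. 1 / (norm (z - complex_of_real s))\<^sup>2 \<partial>M) = enn2real (\<integral>\<^sup>+s. ennreal (1 / (norm (z - complex_of_real s))\<^sup>2) \<partial>M)"
      by (intro integral_eq_nn_integral) (auto simp: M_def)
    also have "(\<integral>\<^sup>+s. ennreal (1 / (norm (z - complex_of_real s))\<^sup>2) \<partial>M) =
        (\<integral>\<^sup>+s. ennreal (p s) * ennreal (1 / (norm (z - complex_of_real s))\<^sup>2) \<partial>lborel)"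
      unfolding M_def by (intro nn_integral_density) auto
    also have "\<dots> = (\<integral>\<^sup>+s. ennreal (1 / Im z) * ennreal (p s * (Im z / (norm (z - complex_of_real s))\<^sup>2)) \<partial>lborel)"
      using z p0 by (intro nn_integral_cong) (simp add: ennreal_mult'[symmetric])
    also have "\<dots> = ennreal (1 / Im z) * ennreal (- Im (f z))"
      using z by (subst nn_integral_cmult, simp, subst poisson) simp_all
    also have "\<dots> = ennreal (- Im (f z) / Im z)"
      using z by (simp add: ennreal_mult'[symmetric])
    finally have "(\<integral>s. 1 / (norm (z - complex_of_real s))\<^sup>2 \<partial>M) = - Im (f z) / Im z"
      using neg[of "z + \<i> * complex_of_real \<epsilon>"] z e by (simp add: f_def divide_nonpos_pos)
    then show ?thesis using M.Im_cauchy_transform[OF z] z by simp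
  qed
  then show ?thesis using M by (auto simp: f_def)
qed

text \<open>The right side is twice the integral of s^2 / (s^2 + y^2), which is at least 1/2 where
  |s| >= y. Values of G on the imaginary axis thus control tails, which yields tightness.\<close>

lemma (in real_distribution) prob_tail_le:
  assumes y: "y > 0"
  shows "prob {s. \<bar>s\<bar> \<ge> y} \<le> 2 * (1 + y * Im (cauchy_transform M (Complex 0 y)))"
proof -
  let ?k = "\<lambda>s. 1 / (norm (Complex 0 y - complex_of_real s))\<^sup>2"
  have int: "integrable M ?k" using integrable_norm_resolvent_sq[of "Complex 0 y"] y by simp
  have meas: "{s::real. \<bar>s\<bar> \<ge> y} \<in> sets M" by simp
  have "prob {s. \<bar>s\<bar> \<ge> y} = (\<integral>s. indicator {s. \<bar>s\<bar> \<ge> y} s \<partial>M)" using meas by simp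
  also have "\<dots> \<le> (\<integral>s. 2 * (1 - y\<^sup>2 * ?k s) \<partial>M)"
  proof (rule integral_mono)
    show "integrable M (indicat_real {s. \<bar>s\<bar> \<ge> y})"
      by (intro integrable_bounded[where B = 1]) (auto simp: indicator_def)
    show "integrable M (\<lambda>s. 2 * (1 - y\<^sup>2 * ?k s))"
      by (intro integrable_mult_right Bochner_Integration.integrable_diff int) auto
    fix s
    have k: "?k s = 1 / (s\<^sup>2 + y\<^sup>2)" by (simp add: cmod_power2)
    have pos: "s\<^sup>2 + y\<^sup>2 > 0" using y by (intro add_nonneg_pos) auto
    show "indicat_real {s. \<bar>s\<bar> \<ge> y} s \<le> 2 * (1 - y\<^sup>2 * ?k s)"
    proof (cases "\<bar>s\<bar> \<ge> y")
      case True
      then have "y\<^sup>2 \<le> s\<^sup>2" using y by (metis abs_of_pos abs_le_square_iff)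
      then show ?thesis unfolding k using True pos by (simp add: field_simps)
    next
      case False
      then show ?thesis unfolding k using pos by (simp add: field_simps)
    qed
  qed
  also have "\<dots> = 2 * (1 - y\<^sup>2 * (\<integral>s. ?k s \<partial>M))"
    using int by (simp add: prob_space[simplified] del: times_divide_eq_right)
  also have "y\<^sup>2 * (\<integral>s. ?k s \<partial>M) = - (y * Im (cauchy_transform M (Complex 0 y)))"
    using Im_cauchy_transform[of "Complex 0 y"] y by (simp add: power2_eq_square)
  finally show ?thesis by simp
qed

text \<open>By the open mapping theorem a nonconstant function would take a value vertically above
  the real number f(i).\<close>

lemma holomorphic_real_valued_constant:
  assumes "f holomorphic_on upper_half_plane" "\<And>z. Im z > 0 \<Longrightarrow> Im (f z) = 0"
  shows "f constant_on upper_half_plane"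
proof (rule ccontr)
  assume "\<not> f constant_on upper_half_plane"
  then have op: "open (f ` upper_half_plane)"
    using open_mapping_thm[OF assms(1) open_upper_half_plane convex_connected[OF convex_upper_half_plane] open_upper_half_plane]
    by simp
  have "f \<i> \<in> f ` upper_half_plane" by auto
  then obtain r where r: "r > 0" "ball (f \<i>) r \<subseteq> f ` upper_half_plane"
    using op open_contains_ball by blast
  have "f \<i> + \<i> * complex_of_real (r / 2) \<in> ball (f \<i>) r"
    using r by (simp add: dist_norm norm_mult)
  then have "f \<i> + \<i> * complex_of_real (r / 2) \<in> f ` upper_half_plane" using r by blast
  then obtain z where "Im z > 0" "f z = f \<i> + \<i> * complex_of_real (r / 2)" by auto
  then have "Im (f z) = Im (f \<i>) + r / 2" by simp
  then show False using assms(2)[of z] assms(2)[of \<i>] \<open>Im z > 0\<close> r by simp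
qed

text \<open>The measures for the shifts 1 / (n + 1) are tight because the normalisation of G
  controls their tails uniformly; M is a weak limit of a subsequence. Imaginary parts then agree,
  and decay along the imaginary axis excludes a real constant.\<close>

theorem cauchy_transform_representation:
  fixes G :: "complex \<Rightarrow> complex"
  assumes hol: "G holomorphic_on upper_half_plane"
    and neg: "\<And>z. Im z > 0 \<Longrightarrow> Im (G z) \<le> 0"
    and bound: "\<And>z. Im z > 0 \<Longrightarrow> norm (G z) \<le> 1 / Im z"
    and lim: "((\<lambda>y. Complex 0 y * G (Complex 0 y)) \<longlongrightarrow> 1) at_top"
  obtains M where "real_distribution M" "\<And>z. Im z > 0 \<Longrightarrow> cauchy_transform M z = G z"
proof -
  define e where "e n = 1 / real (Suc n)" for n
  have e: "e n > 0" "e n \<le> 1" for n by (auto simp: e_def)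
  have e0: "e \<longlonglongrightarrow> 0" unfolding e_def using LIMSEQ_inverse_real_of_nat by (simp only: inverse_eq_divide)
  have "\<forall>n. \<exists>M. real_distribution M \<and> (\<forall>z. Im z > 0 \<longrightarrow> Im (cauchy_transform M z) = Im (G (z + \<i> * complex_of_real (e n))))"
    using exists_distribution_shifted[OF hol neg bound lim e(1)] by blast
  then obtain \<mu> where \<mu>: "\<And>n. real_distribution (\<mu> n)"
    "\<And>n z. Im z > 0 \<Longrightarrow> Im (cauchy_transform (\<mu> n) z) = Im (G (z + \<i> * complex_of_real (e n)))"
    by metis
  have "tight \<mu>"
    unfolding tight_def
  proof (intro conjI allI impI \<mu>(1))
    fix \<eta> :: real assume \<eta>: "\<eta> > 0"
    \<comment> \<open>Two factors 1 - d lose at most 2 d, \<open>prob_tail_le\<close> doubles this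
      to 4 d, and d <= \<eta> / 8 leaves room below \<eta>.\<close>
    define d where "d = min (\<eta> / 8) (1 / 2)"
    have d: "0 < d" "d \<le> \<eta> / 8" "d < 1" using \<eta> by (auto simp: d_def)
    have "\<forall>\<^sub>F y in at_top. dist (Complex 0 y * G (Complex 0 y)) 1 < d"
      by (rule tendstoD[OF lim d(1)])
    moreover have "((\<lambda>y::real. 1 / y) \<longlongrightarrow> 0) at_top"
      by (intro tendsto_divide_0[OF tendsto_const] filterlim_at_top_imp_at_infinity filterlim_ident)
    then have "\<forall>\<^sub>F y::real in at_top. 1 / y < d" by (rule order_tendstoD(2)) (rule d(1))
    ultimately have "\<forall>\<^sub>F y in at_top. dist (Complex 0 y * G (Complex 0 y)) 1 < d \<and> 1 / y < d \<and> y > 0"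
      using eventually_gt_at_top[of 0] by (intro eventually_conj)
    then obtain y where y: "\<And>x. x \<ge> y \<Longrightarrow> dist (Complex 0 x * G (Complex 0 x)) 1 < d \<and> 1 / x < d \<and> x > 0"
      unfolding eventually_at_top_linorder by blast
    have y0: "y > 0" "1 / y < d" using y[of y] by auto
    have "measure (\<mu> n) {- y<..y} > 1 - \<eta>" for n
    proof -
      interpret real_distribution "\<mu> n" by (rule \<mu>)
      have "Complex 0 y + \<i> * complex_of_real (e n) = Complex 0 (y + e n)" by (simp add: complex_eq_iff)
      then have im: "Im (cauchy_transform (\<mu> n) (Complex 0 y)) = Im (G (Complex 0 (y + e n)))"
        using \<mu>(2)[of "Complex 0 y" n] y0 by simp
      define h where "h = - ((y + e n) * Im (G (Complex 0 (y + e n))))"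
      have "\<bar>Re (Complex 0 (y + e n) * G (Complex 0 (y + e n)) - 1)\<bar> \<le> dist (Complex 0 (y + e n) * G (Complex 0 (y + e n))) 1"
        unfolding dist_norm by (rule abs_Re_le_cmod)
      also have "\<dots> < d" using y[of "y + e n"] e(1)[of n] by simp
      finally have h: "h > 1 - d" by (simp add: h_def)
      \<comment> \<open>The price of replacing height y + e n by y; it is uniform in n because
        \<open>e n \<le> 1\<close>.\<close>
      have "y / (y + e n) \<ge> 1 - d"
      proof -
        have "e n / (y + e n) \<le> 1 / y" using y0 e[of n] by (intro frac_le) auto
        moreover have "y / (y + e n) = 1 - e n / (y + e n)" using y0 e(1)[of n] by (simp add: field_simps)
        ultimately show ?thesis using y0 by simp
      qed
      then have "(1 - d) * (1 - d) \<le> y / (y + e n) * h" using h d by (intro mult_mono) auto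
      also have "\<dots> = - (y * Im (G (Complex 0 (y + e n))))"
        using y0 e(1)[of n] by (simp add: h_def)
      finally have "1 + y * Im (G (Complex 0 (y + e n))) \<le> 1 - (1 - d) * (1 - d)" by simp
      also have "\<dots> \<le> 2 * d" by (simp add: algebra_simps)
      finally have "prob {s. \<bar>s\<bar> \<ge> y} \<le> 4 * d" using prob_tail_le[OF y0(1)] im by simp
      also have "\<dots> < \<eta>" using d \<eta> by simp
      finally have "prob {s. \<bar>s\<bar> \<ge> y} < \<eta>" .
      moreover have "1 - prob {s. \<bar>s\<bar> \<ge> y} = prob (UNIV - {s. \<bar>s\<bar> \<ge> y})"
        using prob_compl[of "{s. \<bar>s\<bar> \<ge> y}"] by simp
      moreover have "prob (UNIV - {s. \<bar>s\<bar> \<ge> y}) \<le> prob {- y<..y}"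
        by (intro finite_measure_mono) auto
      ultimately show ?thesis by simp
    qed
    then show "\<exists>a b. a < b \<and> (\<forall>n. measure (\<mu> n) {a<..b} > 1 - \<eta>)"
      using y0 by (intro exI[of _ "- y"] exI[of _ y]) auto
  qed
  then obtain r M where r: "strict_mono (r :: nat \<Rightarrow> nat)" and M: "real_distribution M"
    and conv: "weak_conv_m (\<mu> \<circ> id \<circ> r) M"
    using tight_imp_convergent_subsubsequence[of \<mu> id] strict_mono_id by blast
  interpret M: real_distribution M by (rule M)
  have Im_eq: "Im (cauchy_transform M z) = Im (G z)" if z: "Im z > 0" for z
  proof -
    have "(\<lambda>n. cauchy_transform ((\<mu> \<circ> id \<circ> r) n) z) \<longlonglongrightarrow> cauchy_transform M z"
      unfolding cauchy_transform_def
    proof (rule weak_conv_imp_integral_bdd_continuous_conv[OF _ M conv])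
      show "real_distribution ((\<mu> \<circ> id \<circ> r) n)" for n using \<mu>(1) by simp
      show "isCont (\<lambda>s. 1 / (z - complex_of_real s)) s" for s
        using upper_half_plane_diff_of_real_nonzero[OF z, of s] by (intro continuous_intros) auto
      show "norm (1 / (z - complex_of_real s)) \<le> 1 / Im z" for s
        by (rule norm_inverse_diff_of_real_le[OF z])
    qed
    then have "(\<lambda>n. Im (cauchy_transform (\<mu> (r n)) z)) \<longlonglongrightarrow> Im (cauchy_transform M z)"
      using tendsto_Im by force
    then have 1: "(\<lambda>n. Im (G (z + \<i> * complex_of_real (e (r n))))) \<longlonglongrightarrow> Im (cauchy_transform M z)"
      unfolding \<mu>(2)[OF z] .
    have "isCont G z"
      using holomorphic_on_imp_continuous_on[OF hol] z open_upper_half_plane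
      by (simp add: continuous_on_eq_continuous_at)
    moreover have "(\<lambda>n. z + \<i> * complex_of_real (e (r n))) \<longlonglongrightarrow> z + \<i> * complex_of_real 0"
      using LIMSEQ_subseq_LIMSEQ[OF e0 r] by (intro tendsto_intros) (simp add: o_def)
    ultimately have "(\<lambda>n. G (z + \<i> * complex_of_real (e (r n)))) \<longlonglongrightarrow> G z"
      by (intro isCont_tendsto_compose[of z G]) auto
    then have "(\<lambda>n. Im (G (z + \<i> * complex_of_real (e (r n))))) \<longlonglongrightarrow> Im (G z)" by (rule tendsto_Im)
    then show ?thesis by (rule LIMSEQ_unique[OF 1])
  qed
  have "(\<lambda>z. cauchy_transform M z - G z) constant_on upper_half_plane"
    using Im_eq by (intro holomorphic_real_valued_constant holomorphic_intros M.holomorphic_cauchy_transform hol) auto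
  then obtain c where c: "\<And>z. Im z > 0 \<Longrightarrow> cauchy_transform M z - G z = c"
    by (auto simp: constant_on_def)
  have "c = 0"
  proof (rule ccontr)
    assume "c \<noteq> 0"
    \<comment> \<open>At height y both functions are at most 1 / y = |c| / 3, too small for their
      difference to be c.\<close>
    define y where "y = 3 / norm c"
    have y: "y > 0" using \<open>c \<noteq> 0\<close> by (simp add: y_def)
    have "norm c \<le> norm (cauchy_transform M (Complex 0 y)) + norm (G (Complex 0 y))"
      using c[of "Complex 0 y"] y norm_triangle_ineq4 by fastforce
    also have "\<dots> \<le> 1 / y + 1 / y"
      using M.norm_cauchy_transform_le[of "Complex 0 y"] bound[of "Complex 0 y"] y by (intro add_mono) auto
    also have "\<dots> = 2 / 3 * norm c" by (simp add: y_def)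
    finally show False using \<open>c \<noteq> 0\<close> by simp
  qed
  then show thesis using that[OF M] c by simp
qed

section \<open>Free and Boolean convolution powers\<close>

lemma cauchy_transform_eq_if_reciprocal_eq:
  "reciprocal_cauchy M z = reciprocal_cauchy N z \<Longrightarrow> cauchy_transform M z = cauchy_transform N z"
  by (metis reciprocal_cauchy_def div_by_1 divide_divide_eq_right mult_1)

text \<open>As the cone is open, analyticity on it depends only on values inside it.\<close>

lemma is_right_inverse_on_cong:
  assumes g: "is_right_inverse_on \<mu> \<alpha> \<beta> g" and eq: "\<And>z. z \<in> truncated_cone \<alpha> \<beta> \<Longrightarrow> g z = h z"
  shows "is_right_inverse_on \<mu> \<alpha> \<beta> h"
  unfolding is_right_inverse_on_def
proof (intro conjI)
  have "g holomorphic_on truncated_cone \<alpha> \<beta>"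
    using g analytic_imp_holomorphic by (auto simp: is_right_inverse_on_def)
  then have "h holomorphic_on truncated_cone \<alpha> \<beta>"
    using eq by (rule holomorphic_transform)
  then show "h analytic_on truncated_cone \<alpha> \<beta>"
    by (simp add: analytic_on_open[OF open_truncated_cone])
  have "((\<lambda>z. g z / z) \<longlongrightarrow> 1) (inf at_infinity (principal (truncated_cone \<alpha> \<beta>)))"
    using g by (simp add: is_right_inverse_on_def)
  then show "((\<lambda>z. h z / z) \<longlongrightarrow> 1) (inf at_infinity (principal (truncated_cone \<alpha> \<beta>)))"
    by (rule Lim_transform_eventually) (simp add: eventually_inf_principal eq)
qed (use g eq in \<open>auto simp: is_right_inverse_on_def\<close>)

lemma is_voiculescu_transform_on_mono:
  assumes "is_voiculescu_transform_on \<mu> \<alpha> \<beta> V" "\<alpha>' \<le> \<alpha>" "\<beta> \<le> \<beta>'"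
  shows "is_voiculescu_transform_on \<mu> \<alpha>' \<beta>' V"
  using assms is_right_inverse_on_mono[OF _ assms(2,3)] truncated_cone_mono[OF assms(2,3)]
  unfolding is_voiculescu_transform_on_def by blast

lemma is_voiculescu_transform_on_iff:
  "is_voiculescu_transform_on \<mu> \<alpha> \<beta> V \<longleftrightarrow> is_right_inverse_on \<mu> \<alpha> \<beta> (\<lambda>z. z + V z)"
proof
  assume "is_voiculescu_transform_on \<mu> \<alpha> \<beta> V"
  then obtain g where g: "is_right_inverse_on \<mu> \<alpha> \<beta> g" "\<And>z. z \<in> truncated_cone \<alpha> \<beta> \<Longrightarrow> V z = g z - z"
    by (auto simp: is_voiculescu_transform_on_def)
  show "is_right_inverse_on \<mu> \<alpha> \<beta> (\<lambda>z. z + V z)"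
    by (rule is_right_inverse_on_cong[OF g(1)]) (simp add: g(2))
next
  assume "is_right_inverse_on \<mu> \<alpha> \<beta> (\<lambda>z. z + V z)"
  then show "is_voiculescu_transform_on \<mu> \<alpha> \<beta> V"
    unfolding is_voiculescu_transform_on_def by (intro exI[of _ "\<lambda>z. z + V z"]) simp
qed

text \<open>The two transforms come with unrelated cones, as happens for a competitor in a
  \<open>THE\<close>; they are compared on a common smaller cone.\<close>

lemma voiculescu_transform_eventually_unique:
  assumes M: "real_distribution M" and "\<alpha>\<^sub>1 > 0" "\<alpha>\<^sub>2 > 0"
    and "is_voiculescu_transform_on M \<alpha>\<^sub>1 \<beta>\<^sub>1 U" "is_voiculescu_transform_on M \<alpha>\<^sub>2 \<beta>\<^sub>2 V"
  obtains \<beta> where "\<beta>\<^sub>1 \<le> \<beta>" "\<beta>\<^sub>2 \<le> \<beta>" "\<And>z. z \<in> truncated_cone (min \<alpha>\<^sub>1 \<alpha>\<^sub>2) \<beta> \<Longrightarrow> U z = V z"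
proof -
  interpret real_distribution M by (rule M)
  let ?a = "min \<alpha>\<^sub>1 \<alpha>\<^sub>2" and ?b = "max \<beta>\<^sub>1 \<beta>\<^sub>2"
  have a: "?a > 0" using assms by simp
  have U: "is_right_inverse_on M ?a ?b (\<lambda>z. z + U z)"
    unfolding is_voiculescu_transform_on_iff[symmetric]
    by (rule is_voiculescu_transform_on_mono[OF assms(4)]) auto
  have V: "is_right_inverse_on M ?a ?b (\<lambda>z. z + V z)"
    unfolding is_voiculescu_transform_on_iff[symmetric]
    by (rule is_voiculescu_transform_on_mono[OF assms(5)]) auto
  obtain \<beta> where "\<beta> \<ge> ?b" "\<And>z. z \<in> truncated_cone ?a \<beta> \<Longrightarrow> z + U z = z + V z"
    by (rule right_inverse_eventually_unique[OF a U V]) (rule that)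
  then show thesis by (intro that[of \<beta>]) auto
qed

lemma eq_if_voiculescu_transforms_eq:
  assumes "real_distribution M" "real_distribution N" "\<alpha> > 0"
    and U: "is_voiculescu_transform_on M \<alpha> \<beta> U" and V: "is_voiculescu_transform_on N \<alpha> \<beta> V"
    and eq: "\<And>z. z \<in> truncated_cone \<alpha> \<beta> \<Longrightarrow> U z = V z"
  shows "M = N"
proof (rule real_distribution_eqI_cauchy_transform[OF assms(1,2)])
  have "is_right_inverse_on N \<alpha> \<beta> (\<lambda>z. z + U z)"
    using V unfolding is_voiculescu_transform_on_iff by (rule is_right_inverse_on_cong) (simp add: eq)
  then show "cauchy_transform M z = cauchy_transform N z" if "Im z > 0" for z
    using U that unfolding is_voiculescu_transform_on_iff
    by (intro cauchy_transform_eq_if_common_right_inverse[OF assms(1-3)])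
qed

text \<open>A competing measure brings its own cone and its own transforms. Deep in the smaller cone
  these agree with U and V, so both measures have the same transform there.\<close>

lemma free_convolution_eqI:
  assumes M: "real_distribution M" and N: "real_distribution N" and R: "real_distribution R"
    and a: "\<alpha> > 0" and b: "\<beta> > 0"
    and U: "is_voiculescu_transform_on M \<alpha> \<beta> U" and V: "is_voiculescu_transform_on N \<alpha> \<beta> V"
    and W: "is_voiculescu_transform_on R \<alpha> \<beta> (\<lambda>z. U z + V z)"
  shows "free_convolution M N = R"
  unfolding free_convolution_def
proof (rule the_equality)
  show "real_distribution R \<and> (\<exists>\<alpha>>0. \<exists>\<beta>>0. \<exists>U V. is_voiculescu_transform_on M \<alpha> \<beta> U \<and>
      is_voiculescu_transform_on N \<alpha> \<beta> V \<and> is_voiculescu_transform_on R \<alpha> \<beta> (\<lambda>z. U z + V z))"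
    using R a b U V W by blast
next
  fix R' assume "real_distribution R' \<and> (\<exists>\<alpha>>0. \<exists>\<beta>>0. \<exists>U V. is_voiculescu_transform_on M \<alpha> \<beta> U \<and>
      is_voiculescu_transform_on N \<alpha> \<beta> V \<and> is_voiculescu_transform_on R' \<alpha> \<beta> (\<lambda>z. U z + V z))"
  then obtain \<alpha>' \<beta>' U' V' where R': "real_distribution R'" and a': "\<alpha>' > 0"
    and U': "is_voiculescu_transform_on M \<alpha>' \<beta>' U'" and V': "is_voiculescu_transform_on N \<alpha>' \<beta>' V'"
    and W': "is_voiculescu_transform_on R' \<alpha>' \<beta>' (\<lambda>z. U' z + V' z)" by blast
  obtain b1 where b1: "\<beta> \<le> b1" "\<beta>' \<le> b1" "\<And>z. z \<in> truncated_cone (min \<alpha> \<alpha>') b1 \<Longrightarrow> U z = U' z"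
    by (rule voiculescu_transform_eventually_unique[OF M a a' U U']) (rule that)
  obtain b2 where b2: "\<beta> \<le> b2" "\<beta>' \<le> b2" "\<And>z. z \<in> truncated_cone (min \<alpha> \<alpha>') b2 \<Longrightarrow> V z = V' z"
    by (rule voiculescu_transform_eventually_unique[OF N a a' V V']) (rule that)
  have eq: "U' z + V' z = U z + V z" if "z \<in> truncated_cone (min \<alpha> \<alpha>') (max b1 b2)" for z
    using that b1(3)[of z] b2(3)[of z] by (simp add: truncated_cone_def)
  show "R' = R"
  proof (rule eq_if_voiculescu_transforms_eq[OF R' R _ _ _ eq])
    show "is_voiculescu_transform_on R' (min \<alpha> \<alpha>') (max b1 b2) (\<lambda>z. U' z + V' z)"
      by (rule is_voiculescu_transform_on_mono[OF W']) (use b1 in auto)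
    show "is_voiculescu_transform_on R (min \<alpha> \<alpha>') (max b1 b2) (\<lambda>z. U z + V z)"
      by (rule is_voiculescu_transform_on_mono[OF W]) (use b1 in auto)
  qed (use a a' in auto)
qed

lemma free_power_eqI:
  assumes M: "real_distribution M" and R: "real_distribution R"
    and a: "\<alpha> > 0" and b: "\<beta> > 0" and V: "is_voiculescu_transform_on M \<alpha> \<beta> V"
    and W: "is_voiculescu_transform_on R \<alpha> \<beta> (\<lambda>z. complex_of_real s * V z)"
  shows "free_power M s = R"
  unfolding free_power_def
proof (rule the_equality)
  show "real_distribution R \<and> (\<exists>\<alpha>>0. \<exists>\<beta>>0. \<exists>V. is_voiculescu_transform_on M \<alpha> \<beta> V \<and>
      is_voiculescu_transform_on R \<alpha> \<beta> (\<lambda>z. complex_of_real s * V z))"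
    using R a b V W by blast
next
  fix R' assume "real_distribution R' \<and> (\<exists>\<alpha>>0. \<exists>\<beta>>0. \<exists>V. is_voiculescu_transform_on M \<alpha> \<beta> V \<and>
      is_voiculescu_transform_on R' \<alpha> \<beta> (\<lambda>z. complex_of_real s * V z))"
  then obtain \<alpha>' \<beta>' V' where R': "real_distribution R'" and a': "\<alpha>' > 0"
    and V': "is_voiculescu_transform_on M \<alpha>' \<beta>' V'"
    and W': "is_voiculescu_transform_on R' \<alpha>' \<beta>' (\<lambda>z. complex_of_real s * V' z)" by blast
  obtain b1 where b1: "\<beta> \<le> b1" "\<beta>' \<le> b1" "\<And>z. z \<in> truncated_cone (min \<alpha> \<alpha>') b1 \<Longrightarrow> V z = V' z"
    by (rule voiculescu_transform_eventually_unique[OF M a a' V V']) (rule that)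
  have eq: "complex_of_real s * V' z = complex_of_real s * V z" if "z \<in> truncated_cone (min \<alpha> \<alpha>') b1" for z
    using b1(3)[OF that] by simp
  show "R' = R"
  proof (rule eq_if_voiculescu_transforms_eq[OF R' R _ _ _ eq])
    show "is_voiculescu_transform_on R' (min \<alpha> \<alpha>') b1 (\<lambda>z. complex_of_real s * V' z)"
      by (rule is_voiculescu_transform_on_mono[OF W']) (use b1 in auto)
    show "is_voiculescu_transform_on R (min \<alpha> \<alpha>') b1 (\<lambda>z. complex_of_real s * V z)"
      by (rule is_voiculescu_transform_on_mono[OF W]) (use b1 in auto)
  qed (use a a' in auto)
qed

lemma boolean_power_eqI:
  assumes R: "real_distribution R"
    and eq: "\<And>z. Im z > 0 \<Longrightarrow> reciprocal_cauchy R z =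
      complex_of_real s * reciprocal_cauchy M z + (1 - complex_of_real s) * z"
  shows "boolean_power M s = R"
  unfolding boolean_power_def
proof (rule the_equality)
  fix R' assume R': "real_distribution R' \<and> (\<forall>z\<in>upper_half_plane. reciprocal_cauchy R' z =
      complex_of_real s * reciprocal_cauchy M z + (1 - complex_of_real s) * z)"
  show "R' = R"
    by (rule real_distribution_eqI_cauchy_transform[OF _ R])
      (use R' eq in \<open>auto intro!: cauchy_transform_eq_if_reciprocal_eq\<close>)
qed (use R eq in auto)

section \<open>Witness measures and the identity for the transform\<close>

context real_distribution
begin

text \<open>Subtracting G raises the imaginary part, so 1 / (z - G(z)) obeys the bound 1 / Im z of
  the representation theorem. For \<nu> this produces \<mu>; for the free convolution it produces
  the Boolean power.\<close>

lemma exists_reciprocal_cauchy_representation: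
  obtains N where "real_distribution N" "\<And>z. Im z > 0 \<Longrightarrow> reciprocal_cauchy N z = z - cauchy_transform M z"
proof -
  let ?G = "\<lambda>z. 1 / (z - cauchy_transform M z)"
  have Im: "Im (z - cauchy_transform M z) \<ge> Im z" if "Im z > 0" for z
    using Im_cauchy_transform_neg[OF that] by simp
  have nz: "z - cauchy_transform M z \<noteq> 0" if "Im z > 0" for z
    using Im[OF that] that by (metis not_le zero_complex.sel(2))
  obtain N where N: "real_distribution N" "\<And>z. Im z > 0 \<Longrightarrow> cauchy_transform N z = ?G z"
  proof (rule cauchy_transform_representation[of ?G])
    show "?G holomorphic_on upper_half_plane"
      using nz by (intro holomorphic_intros holomorphic_cauchy_transform) auto
    fix z :: complex assume z: "Im z > 0"
    show "Im (?G z) \<le> 0" using Im[OF z] z by (simp add: Im_divide divide_nonpos_nonneg)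
    have "Im z \<le> norm (z - cauchy_transform M z)"
      using Im[OF z] abs_Im_le_cmod[of "z - cauchy_transform M z"] by linarith
    then show "norm (?G z) \<le> 1 / Im z"
      using z by (simp add: norm_divide frac_le)
  next
    have "((\<lambda>y. cauchy_transform M (Complex 0 y) / Complex 0 y) \<longlongrightarrow> 0) at_top"
    proof (rule Lim_null_comparison)
      show "\<forall>\<^sub>F y in at_top. norm (cauchy_transform M (Complex 0 y) / Complex 0 y) \<le> (1 / y) * (1 / y)"
        using eventually_gt_at_top[of 0]
      proof eventually_elim
        fix y :: real assume y: "y > 0"
        have ny: "norm (Complex 0 y) = y" using y by (simp add: cmod_def)
        have "norm (cauchy_transform M (Complex 0 y) / Complex 0 y) = norm (cauchy_transform M (Complex 0 y)) * (1 / y)"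
          using ny by (simp add: norm_divide)
        also have "\<dots> \<le> (1 / y) * (1 / y)"
          using norm_cauchy_transform_le[of "Complex 0 y"] y by (intro mult_right_mono) auto
        finally show "norm (cauchy_transform M (Complex 0 y) / Complex 0 y) \<le> (1 / y) * (1 / y)" .
      qed
      have "((\<lambda>y::real. 1 / y) \<longlongrightarrow> 0) at_top"
        by (intro tendsto_divide_0[OF tendsto_const] filterlim_at_top_imp_at_infinity filterlim_ident)
      from tendsto_mult[OF this this] show "((\<lambda>y::real. (1 / y) * (1 / y)) \<longlongrightarrow> 0) at_top" by simp
    qed
    then have "((\<lambda>y. 1 / (1 - cauchy_transform M (Complex 0 y) / Complex 0 y)) \<longlongrightarrow> 1 / (1 - 0)) at_top"
      by (intro tendsto_intros) auto
    then have "((\<lambda>y. 1 / (1 - cauchy_transform M (Complex 0 y) / Complex 0 y)) \<longlongrightarrow> 1) at_top" by simp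
    then show "((\<lambda>y. Complex 0 y * ?G (Complex 0 y)) \<longlongrightarrow> 1) at_top"
    proof (rule Lim_transform_eventually)
      show "\<forall>\<^sub>F y in at_top. 1 / (1 - cauchy_transform M (Complex 0 y) / Complex 0 y) = Complex 0 y * ?G (Complex 0 y)"
        using eventually_gt_at_top[of 0]
      proof eventually_elim
        fix y :: real assume "y > 0"
        then have "Complex 0 y \<noteq> 0" by (simp add: complex_eq_iff)
        then show "1 / (1 - cauchy_transform M (Complex 0 y) / Complex 0 y) = Complex 0 y * ?G (Complex 0 y)"
          by (simp add: divide_simps)
      qed
    qed
  qed (rule that)
  have "reciprocal_cauchy N z = z - cauchy_transform M z" if "Im z > 0" for z
    using N(2)[OF that] by (simp add: reciprocal_cauchy_def)
  then show thesis by (rule that[OF N(1)])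
qed

context
  fixes t :: real
  assumes t: "t > 0"
begin

text \<open>S is arbitrary while \<omega> belongs to M: both S = M and the measure represented by M
  are used. The bound 1 / Im z survives since \<omega> does not lower imaginary parts.\<close>

lemma exists_subordinated_distribution:
  assumes S: "real_distribution S"
  obtains R where "real_distribution R" "\<And>z. Im z > 0 \<Longrightarrow> cauchy_transform R z = cauchy_transform S (subordination t z)"
proof -
  interpret S: real_distribution S by (rule S)
  let ?G = "\<lambda>z. cauchy_transform S (subordination t z)"
  have "(cauchy_transform S \<circ> subordination t) holomorphic_on upper_half_plane"
    using Im_subordination_pos[OF t]
    by (intro holomorphic_on_compose_gen[OF holomorphic_subordination[OF t] S.holomorphic_cauchy_transform]) auto
  then have hol: "?G holomorphic_on upper_half_plane" by (simp add: o_def)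
  have neg: "Im (?G z) \<le> 0" if "Im z > 0" for z
    using S.Im_cauchy_transform_neg[OF Im_subordination_pos[OF t that]] by simp
  have bd: "norm (?G z) \<le> 1 / Im z" if z: "Im z > 0" for z
  proof -
    have "norm (?G z) \<le> 1 / Im (subordination t z)"
      by (rule S.norm_cauchy_transform_le[OF Im_subordination_pos[OF t z]])
    also have "\<dots> \<le> 1 / Im z"
      using Im_subordination_ge[OF t z] z by (intro divide_left_mono) auto
    finally show ?thesis .
  qed
  have lim: "((\<lambda>y. Complex 0 y * ?G (Complex 0 y)) \<longlongrightarrow> 1) at_top"
  proof (intro S.cauchy_transform_along_imaginary subordination_div_tendsto[OF t])
    show "y \<le> Im (subordination t (Complex 0 y))" if "y > 0" for y
      using Im_subordination_ge[OF t, of "Complex 0 y"] that by simp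
  qed
  show thesis
    by (rule cauchy_transform_representation[OF hol neg bd lim]) (assumption | rule that)+
qed

text \<open>\<open>w + t G\<^sub>M(w)\<close> inverts the subordination function, so composing it with a right inverse of
  \<open>F\<^sub>S\<close> gives a right inverse of \<open>F\<^sub>R\<close>.\<close>

lemma is_right_inverse_on_subordinated:
  assumes a: "\<alpha> > 0"
    and R: "\<And>z. Im z > 0 \<Longrightarrow> cauchy_transform R z = cauchy_transform S (subordination t z)"
    and g: "is_right_inverse_on S \<alpha> \<beta> g"
  obtains \<beta>' where "\<beta>' \<ge> \<beta>"
    "\<And>b. b \<ge> \<beta>' \<Longrightarrow> is_right_inverse_on R \<alpha> b (\<lambda>u. g u + complex_of_real t * cauchy_transform M (g u))"
proof -
  obtain b0 where b0: "\<And>z. z \<in> truncated_cone \<alpha> \<beta> \<Longrightarrow> norm z \<ge> b0 \<Longrightarrow> norm (g z - z) \<le> norm z / (2 * (1 + \<alpha>))"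
    by (rule right_inverse_near[OF a g]) (rule that)
  \<comment> \<open>The height 4 t + 1 gives y = Im (g u) at least 2 t + 1/2, hence t / y < y. So
    adding t G(g u) cannot push g u out of the half-plane.\<close>
  define \<beta>' where "\<beta>' = max (max \<beta> b0) (4 * t + 1)"
  have "is_right_inverse_on R \<alpha> b (\<lambda>u. g u + complex_of_real t * cauchy_transform M (g u))" if b: "b \<ge> \<beta>'" for b
  proof -
    let ?h = "\<lambda>u. g u + complex_of_real t * cauchy_transform M (g u)"
    have bs: "b \<ge> \<beta>" "b \<ge> b0" "b \<ge> 4 * t + 1" using b by (auto simp: \<beta>'_def)
    have gb: "is_right_inverse_on S \<alpha> b g" by (rule is_right_inverse_on_mono[OF g]) (use bs in auto)
    have Im: "Im u > 4 * t + 1" "Im (g u) \<ge> Im u / 2" "Im (g u) > 0" "Im (?h u) > 0" "norm (cauchy_transform M (g u)) \<le> 2"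
      if u: "u \<in> truncated_cone \<alpha> b" for u
    proof -
      have Iu: "Im u > b" using u by (simp add: truncated_cone_def)
      then show 1: "Im u > 4 * t + 1" using bs by simp
      have "norm u \<ge> b0" using Iu bs abs_Im_le_cmod[of u] by simp
      moreover have "u \<in> truncated_cone \<alpha> \<beta>" using u bs by (auto simp: truncated_cone_def)
      ultimately have "norm (g u - u) \<le> norm u / (2 * (1 + \<alpha>))" by (intro b0)
      then show 2: "Im (g u) \<ge> Im u / 2" by (rule truncated_cone_ball(1)[OF u a])
      then show 3: "Im (g u) > 0" using 1 t by simp
      let ?y = "Im (g u)"
      have y: "?y \<ge> 2 * t + 1/2" using 1 2 by simp
      have G: "norm (cauchy_transform M (g u)) \<le> 1 / ?y" by (rule norm_cauchy_transform_le[OF 3])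
      have "1 / ?y \<le> 1 / (1/2)" using y t by (intro divide_left_mono) auto
      then show "norm (cauchy_transform M (g u)) \<le> 2" using G by simp
      have "- Im (cauchy_transform M (g u)) \<le> 1 / ?y"
        using G abs_Im_le_cmod[of "cauchy_transform M (g u)"] by linarith
      then have "- (t * Im (cauchy_transform M (g u))) \<le> t * (1 / ?y)"
        using mult_left_mono[of "- Im (cauchy_transform M (g u))" "1 / ?y" t] t by simp
      also have "t * (1 / ?y) < ?y"
      proof -
        have "?y * ?y \<ge> (2 * t + 1/2) * (1/2)" using y t by (intro mult_mono) auto
        then have "t < ?y * ?y" using t by (simp add: algebra_simps)
        then show ?thesis using 3 by (simp add: divide_simps)
      qed
      finally show "Im (?h u) > 0" by simp
    qed
    show ?thesis
      unfolding is_right_inverse_on_def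
    proof (intro conjI ballI)
      have "g holomorphic_on truncated_cone \<alpha> b"
        using gb analytic_imp_holomorphic by (auto simp: is_right_inverse_on_def)
      moreover have "(cauchy_transform M \<circ> g) holomorphic_on truncated_cone \<alpha> b"
        using Im(3) by (intro holomorphic_on_compose_gen[OF \<open>g holomorphic_on truncated_cone \<alpha> b\<close> holomorphic_cauchy_transform]) auto
      then have "(\<lambda>u. cauchy_transform M (g u)) holomorphic_on truncated_cone \<alpha> b" by (simp add: o_def)
      ultimately have "?h holomorphic_on truncated_cone \<alpha> b" by (intro holomorphic_intros)
      then show "?h analytic_on truncated_cone \<alpha> b" by (simp add: analytic_on_open[OF open_truncated_cone])
      show "?h ` truncated_cone \<alpha> b \<subseteq> upper_half_plane" using Im(4) by auto
      show "reciprocal_cauchy R (?h u) = u" if u: "u \<in> truncated_cone \<alpha> b" for u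
      proof -
        have "cauchy_transform R (?h u) = cauchy_transform S (g u)"
          using R[OF Im(4)[OF u]] subordination_left_inverse[OF t Im(3)[OF u] Im(4)[OF u]] by simp
        then show ?thesis using gb u by (simp add: is_right_inverse_on_def reciprocal_cauchy_def)
      qed
      let ?F = "inf at_infinity (principal (truncated_cone \<alpha> b))"
      have "((\<lambda>u. complex_of_real t * cauchy_transform M (g u) / u) \<longlongrightarrow> 0) ?F"
      proof (rule Lim_null_comparison)
        show "\<forall>\<^sub>F u in ?F. norm (complex_of_real t * cauchy_transform M (g u) / u) \<le> norm (complex_of_real (2 * t) / u)"
          unfolding eventually_inf_principal
        proof (intro always_eventually allI impI)
          fix u assume u: "u \<in> truncated_cone \<alpha> b"
          show "norm (complex_of_real t * cauchy_transform M (g u) / u) \<le> norm (complex_of_real (2 * t) / u)"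
            unfolding norm_divide norm_mult using Im(5)[OF u] t by (intro divide_right_mono) (auto simp: norm_mult)
        qed
        have "((\<lambda>u::complex. complex_of_real (2 * t) / u) \<longlongrightarrow> 0) at_infinity"
          by (intro tendsto_divide_0[OF tendsto_const] filterlim_ident)
        then show "((\<lambda>u::complex. norm (complex_of_real (2 * t) / u)) \<longlongrightarrow> 0) ?F"
          by (intro tendsto_norm_zero) (rule tendsto_mono[OF inf_le1])
      qed
      moreover have "((\<lambda>u. g u / u) \<longlongrightarrow> 1) ?F" using gb by (simp add: is_right_inverse_on_def)
      ultimately show "((\<lambda>u. ?h u / u) \<longlongrightarrow> 1) ?F"
        using tendsto_add by (fastforce simp: add_divide_distrib)
    qed
  qed
  then show thesis by (intro that[of \<beta>']) (auto simp: \<beta>'_def)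
qed

text \<open>For the right inverse g of F_M one has G_M(g u) = 1 / u, so the inverse g + t G_M(g)
  exceeds g by exactly the semicircular contribution t / u.\<close>

lemma cauchy_transform_free_convolution_semicircular:
  shows "real_distribution (free_convolution M (semicircular t))"
    and "Im z > 0 \<Longrightarrow> cauchy_transform (free_convolution M (semicircular t)) z = cauchy_transform M (subordination t z)"
proof -
  have MM: "real_distribution M" ..
  obtain R where R: "real_distribution R" "\<And>z. Im z > 0 \<Longrightarrow> cauchy_transform R z = cauchy_transform M (subordination t z)"
    by (rule exists_subordinated_distribution[OF MM]) (rule that)
  obtain \<beta>\<^sub>0 g where g: "\<beta>\<^sub>0 > 0" "is_right_inverse_on M 1 \<beta>\<^sub>0 g"
    by (rule exists_right_inverse[of 1]) (simp, rule that)
  obtain \<beta>\<^sub>1 where \<beta>\<^sub>1: "\<beta>\<^sub>1 \<ge> \<beta>\<^sub>0" "\<And>b. b \<ge> \<beta>\<^sub>1 \<Longrightarrow> is_right_inverse_on R 1 b (\<lambda>u. g u + complex_of_real t * cauchy_transform M (g u))"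
    by (rule is_right_inverse_on_subordinated[OF zero_less_one R(2) g(2)]) (assumption, rule that)
  define \<beta> where "\<beta> = max \<beta>\<^sub>1 (sqrt t)"
  have gb: "is_right_inverse_on M 1 \<beta> g"
    by (rule is_right_inverse_on_mono[OF g(2)]) (use \<beta>\<^sub>1(1) in \<open>auto simp: \<beta>_def\<close>)
  have "free_convolution M (semicircular t) = R"
  proof (rule free_convolution_eqI[OF MM real_distribution_semicircular[OF t] R(1), of 1 \<beta> "\<lambda>u. g u - u" "\<lambda>u. complex_of_real t / u"])
    show "is_voiculescu_transform_on M 1 \<beta> (\<lambda>u. g u - u)"
      unfolding is_voiculescu_transform_on_iff using gb by simp
    show "is_voiculescu_transform_on (semicircular t) 1 \<beta> (\<lambda>u. complex_of_real t / u)"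
      unfolding is_voiculescu_transform_on_iff
      by (rule is_right_inverse_on_semicircular[OF t]) (simp add: \<beta>_def)
    have "is_right_inverse_on R 1 \<beta> (\<lambda>u. g u + complex_of_real t * cauchy_transform M (g u))"
      by (rule \<beta>\<^sub>1(2)) (simp add: \<beta>_def)
    then show "is_voiculescu_transform_on R 1 \<beta> (\<lambda>u. g u - u + complex_of_real t / u)"
      unfolding is_voiculescu_transform_on_iff
    proof (rule is_right_inverse_on_cong)
      fix u assume "u \<in> truncated_cone 1 \<beta>"
      then have "reciprocal_cauchy M (g u) = u" using gb by (simp add: is_right_inverse_on_def)
      then have "cauchy_transform M (g u) = 1 / u"
        by (metis reciprocal_cauchy_def div_by_1 divide_divide_eq_right mult_1)
      then show "g u + complex_of_real t * cauchy_transform M (g u) = u + (g u - u + complex_of_real t / u)" by simp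
    qed
  qed (use g(1) \<beta>\<^sub>1(1) in \<open>auto simp: \<beta>_def\<close>)
  then show "real_distribution (free_convolution M (semicircular t))"
    "Im z > 0 \<Longrightarrow> cauchy_transform (free_convolution M (semicircular t)) z = cauchy_transform M (subordination t z)"
    using R by auto
qed

lemma cauchy_transform_free_power:
  assumes N: "real_distribution N" and FN: "\<And>z. Im z > 0 \<Longrightarrow> reciprocal_cauchy N z = z - cauchy_transform M z"
    and z: "Im z > 0"
  shows "cauchy_transform (free_power N (1 + t)) z = cauchy_transform N (subordination t z)"
proof -
  interpret N: real_distribution N by (rule N)
  obtain R where R: "real_distribution R" "\<And>z. Im z > 0 \<Longrightarrow> cauchy_transform R z = cauchy_transform N (subordination t z)"
    by (rule exists_subordinated_distribution[OF N]) (rule that)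
  obtain \<beta>\<^sub>0 g where g: "\<beta>\<^sub>0 > 0" "is_right_inverse_on N 1 \<beta>\<^sub>0 g"
    by (rule N.exists_right_inverse[of 1]) (simp, rule that)
  obtain \<beta> where \<beta>: "\<beta> \<ge> \<beta>\<^sub>0" "\<And>b. b \<ge> \<beta> \<Longrightarrow> is_right_inverse_on R 1 b (\<lambda>u. g u + complex_of_real t * cauchy_transform M (g u))"
    by (rule is_right_inverse_on_subordinated[OF zero_less_one R(2) g(2)]) (assumption, rule that)
  have gb: "is_right_inverse_on N 1 \<beta> g"
    by (rule is_right_inverse_on_mono[OF g(2)]) (use \<beta>(1) in auto)
  have "free_power N (1 + t) = R"
  proof (rule free_power_eqI[OF N R(1), of 1 \<beta> "\<lambda>u. g u - u"])
    show "is_voiculescu_transform_on N 1 \<beta> (\<lambda>u. g u - u)"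
      unfolding is_voiculescu_transform_on_iff using gb by simp
    show "is_voiculescu_transform_on R 1 \<beta> (\<lambda>u. complex_of_real (1 + t) * (g u - u))"
      unfolding is_voiculescu_transform_on_iff
    proof (rule is_right_inverse_on_cong[OF \<beta>(2)[OF order_refl]])
      fix u assume u: "u \<in> truncated_cone 1 \<beta>"
      then have "reciprocal_cauchy N (g u) = u" "Im (g u) > 0" using gb by (auto simp: is_right_inverse_on_def)
      \<comment> \<open>Evaluated at g u, the representation of F_N says that G_M composed with g is
        the Voiculescu transform of N; adding t times it to g gives u plus 1 + t copies.\<close>
      then have "cauchy_transform M (g u) = g u - u" using FN[of "g u"] by (simp add: algebra_simps)
      then show "g u + complex_of_real t * cauchy_transform M (g u) = u + complex_of_real (1 + t) * (g u - u)"
        by (simp only:) (simp add: algebra_simps)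
    qed
  qed (use g(1) \<beta>(1) in auto)
  then show ?thesis using R(2)[OF z] by simp
qed

text \<open>The witness for the Boolean power is the measure representing the free convolution, so
  the claim follows as soon as that measure satisfies the Boolean relation.\<close>

lemma reciprocal_cauchy_BN_transform:
  assumes N: "real_distribution N" and FN: "\<And>z. Im z > 0 \<Longrightarrow> reciprocal_cauchy N z = z - cauchy_transform M z"
    and z: "Im z > 0"
  shows "reciprocal_cauchy (BN_transform t N) z = z - cauchy_transform (free_convolution M (semicircular t)) z"
proof -
  let ?C = "free_convolution M (semicircular t)"
  interpret C: real_distribution ?C by (rule cauchy_transform_free_convolution_semicircular(1))
  obtain B where B: "real_distribution B" "\<And>z. Im z > 0 \<Longrightarrow> reciprocal_cauchy B z = z - cauchy_transform ?C z"
    by (rule C.exists_reciprocal_cauchy_representation) (rule that)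
  have "BN_transform t N = B"
    unfolding BN_transform_def
  proof (rule boolean_power_eqI[OF B(1)])
    fix z :: complex assume z: "Im z > 0"
    let ?w = "subordination t z"
    have w: "Im ?w > 0" "?w + complex_of_real t * cauchy_transform M ?w = z"
      using Im_subordination_pos[OF t z] subordination_eq[OF t z] by auto
    have F: "reciprocal_cauchy (free_power N (1 + t)) z = ?w - cauchy_transform M ?w"
      using cauchy_transform_free_power[OF N FN z] FN[OF w(1)] by (simp add: reciprocal_cauchy_def)
    have G: "reciprocal_cauchy B z = z - cauchy_transform M ?w"
      using B(2)[OF z] cauchy_transform_free_convolution_semicircular(2)[OF z] by simp
    have nz: "1 + complex_of_real t \<noteq> 0" using t by (simp add: complex_eq_iff)
    have convex_split: "(X + complex_of_real t * z) / (1 + complex_of_real t) =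
        complex_of_real (1 / (1 + t)) * X + (1 - complex_of_real (1 / (1 + t))) * z" for X
    proof -
      define k where "k = 1 + complex_of_real t"
      have k: "k \<noteq> 0" "complex_of_real t = k - 1" "complex_of_real (1 / (1 + t)) = 1 / k"
        using nz by (auto simp: k_def)
      show ?thesis unfolding k(2,3) using k(1) by (simp add: field_simps)
    qed
    \<comment> \<open>Here z = \<omega> + t G_M(\<omega>) is inserted; dividing by 1 + t yields the
      Boolean relation with exponent 1 / (1 + t).\<close>
    have "(1 + complex_of_real t) * (z - cauchy_transform M ?w) = (?w - cauchy_transform M ?w) + complex_of_real t * z"
      using w(2) by (simp add: algebra_simps)
    then have "z - cauchy_transform M ?w = ((?w - cauchy_transform M ?w) + complex_of_real t * z) / (1 + complex_of_real t)"
      using nz by (simp add: eq_divide_eq mult.commute)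
    also have "\<dots> = complex_of_real (1 / (1 + t)) * (?w - cauchy_transform M ?w) + (1 - complex_of_real (1 / (1 + t))) * z"
      using convex_split .
    finally show "reciprocal_cauchy B z = complex_of_real (1 / (1 + t)) * reciprocal_cauchy (free_power N (1 + t)) z +
        (1 - complex_of_real (1 / (1 + t))) * z"
      unfolding F G .
  qed
  then show ?thesis using B(2)[OF z] by simp
qed

end

end

theorem theorem4:
  fixes \<nu> :: "real measure"
  assumes "real_distribution \<nu>"
  shows "(\<exists>!\<mu>. real_distribution \<mu> \<and>
            (\<forall>z \<in> upper_half_plane. - cauchy_transform \<nu> z = reciprocal_cauchy \<mu> z - z)) \<and>
         (\<forall>\<mu>. real_distribution \<mu> \<and>
            (\<forall>z \<in> upper_half_plane. - cauchy_transform \<nu> z = reciprocal_cauchy \<mu> z - z) \<longrightarrow>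
            (\<forall>t>0. \<forall>z \<in> upper_half_plane.
               - cauchy_transform (free_convolution \<nu> (semicircular t)) z =
                 reciprocal_cauchy (BN_transform t \<mu>) z - z))"
proof (intro conjI allI impI ballI)
  interpret real_distribution \<nu> by (rule assms)
  have iff: "- cauchy_transform \<nu> z = reciprocal_cauchy \<mu> z - z \<longleftrightarrow> reciprocal_cauchy \<mu> z = z - cauchy_transform \<nu> z" for \<mu> z
    by (auto simp: algebra_simps)
  obtain N where N: "real_distribution N" "\<And>z. Im z > 0 \<Longrightarrow> reciprocal_cauchy N z = z - cauchy_transform \<nu> z"
    by (rule exists_reciprocal_cauchy_representation) (rule that)
  show "\<exists>!\<mu>. real_distribution \<mu> \<and> (\<forall>z \<in> upper_half_plane. - cauchy_transform \<nu> z = reciprocal_cauchy \<mu> z - z)"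
    unfolding iff
  proof (rule ex1I[of _ N])
    fix \<mu> assume \<mu>: "real_distribution \<mu> \<and> (\<forall>z\<in>upper_half_plane. reciprocal_cauchy \<mu> z = z - cauchy_transform \<nu> z)"
    show "\<mu> = N"
      by (rule real_distribution_eqI_cauchy_transform[OF _ N(1)])
        (use \<mu> N(2) in \<open>auto intro!: cauchy_transform_eq_if_reciprocal_eq\<close>)
  qed (use N in auto)
  fix \<mu> :: "real measure" and t :: real and z :: complex
  assume \<mu>: "real_distribution \<mu> \<and> (\<forall>z \<in> upper_half_plane. - cauchy_transform \<nu> z = reciprocal_cauchy \<mu> z - z)"
    and t: "t > 0" and z: "z \<in> upper_half_plane"
  show "- cauchy_transform (free_convolution \<nu> (semicircular t)) z = reciprocal_cauchy (BN_transform t \<mu>) z - z"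
    using reciprocal_cauchy_BN_transform[OF t, of \<mu> z] \<mu> z by (simp add: iff)
qed

end
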